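(* Let $d\ge 2$. The Fourier transform of any radial function $\Phi\in L^1(\mathbb R^d)$ is $\lfloor\frac{d-2}{2}\rfloor$ times continuously differentiable on $\mathbb R^d\setminus\{0\}$.
   Context: The Fourier transform of $\Phi\in L^1(\mathbb R^d)$ is $\mathcal F_d[\Phi](v)=\int_{\mathbb R^d}e^{-2\pi i\langle x,v\rangle}\Phi(x)\,\mathrm dx$. A function $\Phi$ on $\mathbb R^d$ is radial if $\Phi(Qx)=\Phi(x)$ for all $x\in\mathbb R^d$ and all orthogonal $d\times d$ matrices $Q$. *)

theory Defs
  imports "HOL-Analysis.Analysis"
begin

definition fourier_transform :: "(real ^ 'n \<Rightarrow> complex) \<Rightarrow> real ^ 'n \<Rightarrow> complex" where
  "fourier_transform \<Phi> v =
     integral\<^sup>L lebesgue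
       (\<lambda>x. exp (- (2 * complex_of_real pi * \<i> * complex_of_real (x \<bullet> v))) * \<Phi> x)"

definition radial :: "(real ^ 'n \<Rightarrow> 'b) \<Rightarrow> bool" where
  "radial \<Phi> \<longleftrightarrow>
     (\<forall>Q :: real ^ 'n ^ 'n. orthogonal_matrix Q \<longrightarrow> (\<forall>x. \<Phi> (Q *v x) = \<Phi> x))"

(* The class C^k on an open subset S of a finite-dimensional space. The derivative at x is
   evaluated at each fixed direction v, which avoids iterating function-space types; in finite
   dimension the step agrees with requiring x \<mapsto> Df(x) to be of class C^k. The definition
   is meant for open S only, since differentiability refers to a full neighbourhood of x. *)
primrec continuously_differentiable_on ::
  "nat \<Rightarrow> ('a::euclidean_space \<Rightarrow> 'b::real_normed_vector) \<Rightarrow> 'a set \<Rightarrow> bool" where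
  "continuously_differentiable_on 0 f S \<longleftrightarrow> continuous_on S f"
| "continuously_differentiable_on (Suc k) f S \<longleftrightarrow>
     (\<forall>x\<in>S. f differentiable (at x)) \<and>
     (\<forall>v. continuously_differentiable_on k (\<lambda>x. frechet_derivative f (at x) v) S)"

end

theory Submission
  imports Defs
begin

text \<open>Averaging over the orthogonal group gives
  \<open>F v = \<integral> \<Phi> x * k (2 * pi * norm x * norm v)\<close>, where \<open>k\<close> is the Fourier transform of the
  uniform probability measure on the unit sphere. Rotation invariance of that measure yields Bessel's
  equation \<open>u * k'' + (d - 1) * k' + u * k = 0\<close>. With \<open>\<kappa> s = k (sqrt s)\<close>, every derivative
  \<open>y = \<kappa>\<^bsup>(n)\<^esup>\<close> satisfies \<open>4 * s * y'' + 2 * (d + 2 * n) * y' + y = 0\<close>, and an energy estimate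
  bounds \<open>s ^ p * y\<^sup>2\<close> whenever \<open>2 * p + 2 \<le> d + 2 * n\<close>. For \<open>2 * m + 2 \<le> d\<close> and \<open>n \<le> m\<close>
  the choice \<open>p = m + n\<close> shows that \<open>s ^ n * \<kappa>\<^bsup>(n)\<^esup> s\<close> is bounded, which is what is
  needed to differentiate \<open>m\<close> times under the integral, as a function of \<open>v \<bullet> v > 0\<close>.\<close>

section \<open>Integrals depending on a parameter\<close>

text \<open>The obstacle is that \<open>\<Phi>\<close> is merely integrable: it need not have any
  moments, so differentiating the exponential itself under the integral produces powers of
  \<open>x\<close> that nothing controls. Only the oscillation averaged over a sphere can pay for
  them. With \<open>s\<close> a multiple of \<open>(norm x)\<^sup>2 * (v \<bullet> v)\<close>, each
  derivative in \<open>v \<bullet> v\<close> costs a factor \<open>(norm x)\<^sup>2\<close>. A bound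
  on \<open>s ^ n\<close> times the \<open>n\<close>-th derivative of the kernel buys back exactly
  \<open>(norm x) ^ (2 * n)\<close>, at the price of a negative power of
  \<open>v \<bullet> v\<close>; this is why the origin is excluded. The variable \<open>s\<close> is
  chosen over \<open>sqrt s\<close> because the differentiated equation then keeps its form with the
  dimension \<open>d\<close> replaced by \<open>d + 2 * n\<close>. One energy estimate, with the
  dimension as a parameter, thus serves all derivatives, and it stands in for the asymptotics of
  Bessel functions.\<close>

lemma has_vector_derivative_iff_tendsto:
  "(F has_vector_derivative D) (at x) \<longleftrightarrow> ((\<lambda>y. (F y - F x) /\<^sub>R (y - x)) \<longlongrightarrow> D) (at x)"
proof -
  have "norm (((F y - F x) - (y - x) *\<^sub>R D) /\<^sub>R norm (y - x)) = norm ((F y - F x) /\<^sub>R (y - x) - D)"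
    if "y \<noteq> x" for y
  proof -
    have "(F y - F x) /\<^sub>R (y - x) - D = ((F y - F x) - (y - x) *\<^sub>R D) /\<^sub>R (y - x)"
      using that by (simp add: scaleR_diff_right)
    then show ?thesis by simp
  qed
  then have *: "((\<lambda>y. norm (((F y - F x) - (y - x) *\<^sub>R D) /\<^sub>R norm (y - x))) \<longlongrightarrow> 0) (at x) \<longleftrightarrow>
      ((\<lambda>y. norm ((F y - F x) /\<^sub>R (y - x) - D)) \<longlongrightarrow> 0) (at x)"
    by (intro filterlim_cong) (auto simp: eventually_at_filter)
  have "(F has_vector_derivative D) (at x) \<longleftrightarrow>
      ((\<lambda>y. ((F y - F x) - (y - x) *\<^sub>R D) /\<^sub>R norm (y - x)) \<longlongrightarrow> 0) (at x)"
    unfolding has_vector_derivative_def has_derivative_within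
    by (simp add: bounded_linear_scaleR_left diff_diff_eq divide_inverse_commute)
  also have "\<dots> \<longleftrightarrow> ((\<lambda>y. (F y - F x) /\<^sub>R (y - x)) \<longlongrightarrow> D) (at x)"
    using * unfolding tendsto_norm_zero_iff LIM_zero_iff .
  finally show ?thesis .
qed

text \<open>The mean value inequality turns the bound on \<open>f'\<close> into the same bound on
  the difference quotients. Dominated convergence then applies along an arbitrary sequence tending
  to \<open>s0\<close>.\<close>

lemma has_vector_derivative_integral:
  fixes f :: "real \<Rightarrow> 'a \<Rightarrow> 'b::{banach, second_countable_topology}"
  assumes s0: "s0 \<in> {a<..<b}"
    and f: "\<And>s. s \<in> {a<..<b} \<Longrightarrow> integrable M (f s)"
    and f': "\<And>s x. s \<in> {a<..<b} \<Longrightarrow> x \<in> space M \<Longrightarrow> ((\<lambda>s. f s x) has_vector_derivative f' s x) (at s)"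
    and bound: "\<And>s x. s \<in> {a<..<b} \<Longrightarrow> x \<in> space M \<Longrightarrow> norm (f' s x) \<le> w x"
    and w: "integrable M w"
    and meas: "f' s0 \<in> borel_measurable M"
  shows "((\<lambda>s. \<integral>x. f s x \<partial>M) has_vector_derivative (\<integral>x. f' s0 x \<partial>M)) (at s0)"
  unfolding has_vector_derivative_iff_tendsto
proof -
  have lip: "norm ((f s x - f s0 x) /\<^sub>R (s - s0)) \<le> w x"
    if "s \<in> {a<..<b}" "x \<in> space M" for s x
  proof (cases "s = s0")
    case True
    then show ?thesis using order_trans[OF norm_ge_zero bound[OF that]] by simp
  next
    case False
    have "norm (f s x - f s0 x) \<le> w x * norm (s - s0)"
    proof (rule differentiable_bound[of "{a<..<b}" "\<lambda>s. f s x" "\<lambda>s h. h *\<^sub>R f' s x"])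
      show "((\<lambda>s. f s x) has_derivative (\<lambda>h. h *\<^sub>R f' s x)) (at s within {a<..<b})"
        if "s \<in> {a<..<b}" for s
        using f'[OF that \<open>x \<in> space M\<close>] has_derivative_at_withinI has_vector_derivative_def by blast
      show "onorm (\<lambda>h. h *\<^sub>R f' s x) \<le> w x" if "s \<in> {a<..<b}" for s
        using bound[OF that \<open>x \<in> space M\<close>]
        by (intro onorm_le) (simp add: mult.commute mult_left_mono mult_right_mono)
    qed (use s0 that in auto)
    then show ?thesis using False by (simp add: divide_simps mult.commute)
  qed
  show "((\<lambda>y. ((\<integral>x. f y x \<partial>M) - (\<integral>x. f s0 x \<partial>M)) /\<^sub>R (y - s0)) \<longlongrightarrow> (\<integral>x. f' s0 x \<partial>M)) (at s0)"
    unfolding tendsto_at_iff_sequentially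
  proof safe
    fix X :: "nat \<Rightarrow> real"
    assume X: "\<forall>i. X i \<in> UNIV - {s0}" "X \<longlonglongrightarrow> s0"
    have "eventually (\<lambda>n. X n \<in> {a<..<b}) sequentially"
      using X(2) s0 topological_tendstoD open_greaterThanLessThan by blast
    then obtain N where N: "\<And>n. n \<ge> N \<Longrightarrow> X n \<in> {a<..<b}"
      by (auto simp: eventually_sequentially)
    \<comment> \<open>Dropping the first \<open>N\<close> terms makes the domination hold for every
      index, as dominated convergence requires.\<close>
    let ?Y = "\<lambda>n. X (n + N)"
    have Y: "?Y n \<in> {a<..<b}" "?Y n \<noteq> s0" for n using N[of "n+N"] X(1) by auto
    have Ylim: "?Y \<longlonglongrightarrow> s0" using X(2) by (rule LIMSEQ_ignore_initial_segment)
    have "(\<lambda>n. \<integral>x. (f (?Y n) x - f s0 x) /\<^sub>R (?Y n - s0) \<partial>M) \<longlonglongrightarrow> (\<integral>x. f' s0 x \<partial>M)"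
    proof (rule integral_dominated_convergence[OF meas _ w])
      show "(\<lambda>x. (f (?Y n) x - f s0 x) /\<^sub>R (?Y n - s0)) \<in> borel_measurable M" for n
        using f[OF Y(1)[of n]] f[OF s0] by (intro borel_measurable_integrable) auto
      show "AE x in M. (\<lambda>n. (f (?Y n) x - f s0 x) /\<^sub>R (?Y n - s0)) \<longlonglongrightarrow> f' s0 x"
      proof (rule AE_I2)
        fix x assume "x \<in> space M"
        from f'[OF s0 this] Ylim Y(2)
        show "(\<lambda>n. (f (?Y n) x - f s0 x) /\<^sub>R (?Y n - s0)) \<longlonglongrightarrow> f' s0 x"
          unfolding has_vector_derivative_iff_tendsto tendsto_at_iff_sequentially
          by (auto simp: o_def)
      qed
      show "AE x in M. norm ((f (?Y n) x - f s0 x) /\<^sub>R (?Y n - s0)) \<le> w x" for n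
        using lip[OF Y(1)[of n]] by (intro AE_I2) blast
    qed
    also have "(\<lambda>n. \<integral>x. (f (?Y n) x - f s0 x) /\<^sub>R (?Y n - s0) \<partial>M) =
        (\<lambda>n. ((\<integral>x. f (?Y n) x \<partial>M) - (\<integral>x. f s0 x \<partial>M)) /\<^sub>R (?Y n - s0))"
      using f[OF Y(1)] f[OF s0] by (simp add: Bochner_Integration.integral_diff)
    finally show "((\<lambda>y. ((\<integral>x. f y x \<partial>M) - (\<integral>x. f s0 x \<partial>M)) /\<^sub>R (y - s0)) \<circ> X) \<longlonglongrightarrow> (\<integral>x. f' s0 x \<partial>M)"
      unfolding o_def by (rule LIMSEQ_offset)
  qed
qed

lemma continuous_integral:
  fixes f :: "real \<Rightarrow> 'a \<Rightarrow> 'b::{banach, second_countable_topology}"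
  assumes s0: "s0 \<in> {a<..<b}"
    and f: "\<And>s. s \<in> {a<..<b} \<Longrightarrow> f s \<in> borel_measurable M"
    and cont: "\<And>x. x \<in> space M \<Longrightarrow> isCont (\<lambda>s. f s x) s0"
    and bound: "\<And>s x. s \<in> {a<..<b} \<Longrightarrow> x \<in> space M \<Longrightarrow> norm (f s x) \<le> w x"
    and w: "integrable M w"
  shows "isCont (\<lambda>s. \<integral>x. f s x \<partial>M) s0"
  unfolding continuous_at_sequentially
proof safe
  fix X :: "nat \<Rightarrow> real"
  assume X: "X \<longlonglongrightarrow> s0"
  have "eventually (\<lambda>n. X n \<in> {a<..<b}) sequentially"
    using X s0 topological_tendstoD open_greaterThanLessThan by blast
  then obtain N where N: "\<And>n. n \<ge> N \<Longrightarrow> X n \<in> {a<..<b}"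
    by (auto simp: eventually_sequentially)
  let ?Y = "\<lambda>n. X (n + N)"
  have Y: "?Y n \<in> {a<..<b}" for n using N[of "n+N"] by auto
  have Ylim: "?Y \<longlonglongrightarrow> s0" using X by (rule LIMSEQ_ignore_initial_segment)
  have "(\<lambda>n. \<integral>x. f (?Y n) x \<partial>M) \<longlonglongrightarrow> (\<integral>x. f s0 x \<partial>M)"
  proof (rule integral_dominated_convergence[OF f[OF s0] f[OF Y] w])
    show "AE x in M. (\<lambda>n. f (?Y n) x) \<longlonglongrightarrow> f s0 x"
      by (rule AE_I2) (rule isCont_tendsto_compose[OF cont Ylim])
    show "AE x in M. norm (f (?Y n) x) \<le> w x" for n
      using bound[OF Y] by (intro AE_I2) blast
  qed
  then show "((\<lambda>s. \<integral>x. f s x \<partial>M) \<circ> X) \<longlonglongrightarrow> (\<integral>x. f s0 x \<partial>M)"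
    unfolding o_def by (rule LIMSEQ_offset)
qed

section \<open>Continuously differentiable functions\<close>

lemma continuously_differentiable_on_cong:
  assumes "open S" "\<And>x. x \<in> S \<Longrightarrow> f x = g x" "continuously_differentiable_on k f S"
  shows "continuously_differentiable_on k g S"
  using assms(2,3)
proof (induction k arbitrary: f g)
  case 0
  then show ?case using continuous_on_cong by fastforce
next
  case (Suc k)
  have d: "f differentiable (at x)" if "x \<in> S" for x using Suc.prems that by auto
  have "g differentiable (at x)" if "x \<in> S" for x
    using Suc.prems(1) has_derivative_transform_within_open[OF _ \<open>open S\<close> that, of f _ UNIV g] d[OF that]
    by (metis differentiable_def)
  moreover have "frechet_derivative f (at x) = frechet_derivative g (at x)" if "x \<in> S" for x
    using frechet_derivative_transform_within_open[OF d[OF that] assms(1) that] Suc.prems(1) by blast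
  moreover have "continuously_differentiable_on k (\<lambda>x. frechet_derivative f (at x) v) S" for v
    using Suc.prems by auto
  ultimately show ?case
    using Suc.IH by (metis (no_types, lifting) continuously_differentiable_on.simps(2))
qed

text \<open>On an open set the chosen \<open>frechet_derivative\<close> agrees with any explicit
  derivative, so the recursion defining the class can be run on a formula.\<close>

lemma continuously_differentiable_on_SucI:
  assumes "open S" "\<And>x. x \<in> S \<Longrightarrow> (f has_derivative f' x) (at x)"
    and "\<And>v. continuously_differentiable_on k (\<lambda>x. f' x v) S"
  shows "continuously_differentiable_on (Suc k) f S"
proof -
  have "frechet_derivative f (at x) = f' x" if "x \<in> S" for x
    using frechet_derivative_at[OF assms(2)[OF that]] by simp
  then have "continuously_differentiable_on k (\<lambda>x. frechet_derivative f (at x) v) S" for v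
    by (intro continuously_differentiable_on_cong[OF assms(1) _ assms(3)[of v]]) simp
  then show ?thesis using assms(2) by (auto simp: differentiable_def)
qed

lemma continuously_differentiable_on_add:
  assumes "open S"
    and "continuously_differentiable_on k f S" "continuously_differentiable_on k g S"
  shows "continuously_differentiable_on k (\<lambda>x. f x + g x) S"
  using assms(2,3)
proof (induction k arbitrary: f g)
  case 0
  then show ?case by (simp add: continuous_on_add)
next
  case (Suc k)
  show ?case
  proof (rule continuously_differentiable_on_SucI[OF assms(1)])
    show "((\<lambda>x. f x + g x) has_derivative
        (\<lambda>v. frechet_derivative f (at x) v + frechet_derivative g (at x) v)) (at x)" if "x \<in> S" for x
      using Suc.prems that by (intro has_derivative_add) (auto simp: frechet_derivative_works[symmetric])
  qed (use Suc in auto)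
qed

text \<open>Polynomials serve as coefficients below because they are stable under directional
  derivatives and under products with linear forms.\<close>

lemma real_polynomial_function_has_derivative:
  assumes "real_polynomial_function p"
  obtains p' where "\<And>x. (p has_derivative p' x) (at x)"
    "\<And>v. real_polynomial_function (\<lambda>x. p' x v)"
proof -
  have "\<exists>p'. (\<forall>x. (p has_derivative p' x) (at x)) \<and> (\<forall>v. real_polynomial_function (\<lambda>x. p' x v))"
    using assms
  proof induction
    case (linear f)
    then show ?case
      by (intro exI[of _ "\<lambda>x. f"]) (auto simp: bounded_linear_imp_has_derivative)
  next
    case (const c)
    then show ?case by (intro exI[of _ "\<lambda>x v. 0"]) auto
  next
    case (add f g)
    then obtain f' g' where "\<forall>x. (f has_derivative f' x) (at x)" "\<forall>v. real_polynomial_function (\<lambda>x. f' x v)"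
      "\<forall>x. (g has_derivative g' x) (at x)" "\<forall>v. real_polynomial_function (\<lambda>x. g' x v)" by blast
    then show ?case
      by (intro exI[of _ "\<lambda>x v. f' x v + g' x v"]) (auto intro!: has_derivative_add)
  next
    case (mult f g)
    then obtain f' g' where *: "\<And>x. (f has_derivative f' x) (at x)" "\<And>v. real_polynomial_function (\<lambda>x. f' x v)"
      "\<And>x. (g has_derivative g' x) (at x)" "\<And>v. real_polynomial_function (\<lambda>x. g' x v)" by blast
    have "real_polynomial_function (\<lambda>x. f x * g' x v + f' x v * g x)" for v
      by (intro real_polynomial_function.intros(3,4) * mult.hyps)
    moreover have "((\<lambda>x. f x * g x) has_derivative (\<lambda>v. f x * g' x v + f' x v * g x)) (at x)" for x
      by (intro has_derivative_mult *)
    ultimately show ?case by (intro exI[of _ "\<lambda>x v. f x * g' x v + f' x v * g x"]) simp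
  qed
  with that show thesis by blast
qed

text \<open>Passing to the variable \<open>v \<bullet> v\<close> keeps all coefficients polynomial: each directional
  derivative produces only terms of the form treated here.\<close>
lemma continuously_differentiable_on_inner_self:
  fixes G :: "nat \<Rightarrow> real \<Rightarrow> 'b::real_normed_vector" and p :: "'a::euclidean_space \<Rightarrow> real"
  assumes deriv: "\<And>n s. n < m \<Longrightarrow> s > 0 \<Longrightarrow> (G n has_vector_derivative G (Suc n) s) (at s)"
    and cont: "continuous_on {0<..} (G m)"
    and "real_polynomial_function p" "n + k \<le> m"
  shows "continuously_differentiable_on k (\<lambda>v. p v *\<^sub>R G n (v \<bullet> v)) (UNIV - {0})"
  using assms(3,4)
proof (induction k arbitrary: n p)
  case 0
  have "continuous_on {0<..} (G n)"
  proof (cases "n = m")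
    case False
    then have "isCont (G n) s" if "s > 0" for s
      using 0 deriv[of n s] that has_vector_derivative_continuous by fastforce
    then show ?thesis by (simp add: continuous_at_imp_continuous_on)
  qed (use cont in simp)
  then have "continuous_on (UNIV - {0}) (\<lambda>v::'a. G n (v \<bullet> v))"
    by (rule continuous_on_compose2) (auto intro!: continuous_intros)
  moreover have "continuous_on (UNIV - {0}) p"
    using 0(1) continuous_on_polymonial_function[of p] real_polynomial_function_eq by metis
  ultimately show ?case by (simp add: continuous_on_scaleR)
next
  case (Suc k)
  obtain p' where p': "\<And>x. (p has_derivative p' x) (at x)"
    "\<And>v. real_polynomial_function (\<lambda>x. p' x v)"
    using real_polynomial_function_has_derivative[OF Suc.prems(1)] by blast
  show ?case
  proof (rule continuously_differentiable_on_SucI)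
    \<comment> \<open>The origin is excluded because \<open>G n\<close> is controlled only at
      positive arguments.\<close>
    fix x :: 'a assume "x \<in> UNIV - {0}"
    then have "x \<bullet> x > 0" by simp
    then have G: "(G n has_derivative (\<lambda>h. h *\<^sub>R G (Suc n) (x \<bullet> x))) (at (x \<bullet> x))"
      using deriv[of n "x \<bullet> x"] Suc.prems(2) by (auto simp: has_vector_derivative_def)
    have "((\<lambda>v. v \<bullet> v) has_derivative (\<lambda>h. 2 * (x \<bullet> h))) (at x)"
      by (auto intro!: derivative_eq_intros simp: inner_commute)
    from has_derivative_compose[OF this G]
    have "((\<lambda>v. G n (v \<bullet> v)) has_derivative (\<lambda>h. (2 * (x \<bullet> h)) *\<^sub>R G (Suc n) (x \<bullet> x))) (at x)" .
    from has_derivative_scaleR[OF p'(1) this]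
    show "((\<lambda>v. p v *\<^sub>R G n (v \<bullet> v)) has_derivative
       (\<lambda>h. (p x * (2 * (x \<bullet> h))) *\<^sub>R G (Suc n) (x \<bullet> x) + p' x h *\<^sub>R G n (x \<bullet> x))) (at x)"
      by simp
  next
    fix v :: 'a
    have "real_polynomial_function (\<lambda>x. p x * (2 * (x \<bullet> v)))"
      by (intro real_polynomial_function.intros(4)[OF Suc.prems(1)] real_polynomial_function.intros(4)
          real_polynomial_function.intros(1,2) bounded_linear_inner_left)
    then show "continuously_differentiable_on k (\<lambda>x. (p x * (2 * (x \<bullet> v))) *\<^sub>R G (Suc n) (x \<bullet> x)
        + p' x v *\<^sub>R G n (x \<bullet> x)) (UNIV - {0})"
      \<comment> \<open>The term in \<open>G (Suc n)\<close> uses the whole budget, since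
        \<open>Suc n + k\<close> equals \<open>n + Suc k\<close>; the term in \<open>G n\<close>
        leaves one derivative to spare.\<close>
      using Suc.prems(2) p'(2)
      by (intro continuously_differentiable_on_add Suc.IH[of "\<lambda>x. p x * (2 * (x \<bullet> v))" "Suc n"]
          Suc.IH[of "\<lambda>x. p' x v" n]) auto
  qed auto
qed

section \<open>Decay of solutions of Bessel's equation\<close>

text \<open>By the equation, the natural energy
  \<open>(y s)\<^sup>2 + 4 * s * (y' s)\<^sup>2\<close> has derivative
  \<open>4 * (1 - D) * (y' s)\<^sup>2\<close>. The weight \<open>s ^ p\<close> adds a multiple of
  \<open>p * (y s)\<^sup>2\<close> with the wrong sign; the cross term
  \<open>4 * p * y s * y' s\<close> in \<open>E\<close> is there to cancel it.\<close>

lemma bessel_energy_bound: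
  fixes y y' y'' :: "real \<Rightarrow> real" and D :: real and p :: nat
  assumes y: "\<And>s. s > 0 \<Longrightarrow> (y has_real_derivative y' s) (at s)"
    and y': "\<And>s. s > 0 \<Longrightarrow> (y' has_real_derivative y'' s) (at s)"
    and ode: "\<And>s. s > 0 \<Longrightarrow> 4 * s * y'' s + 2 * D * y' s + y s = 0"
    and D: "D \<ge> 2 * real p + 2"
  obtains C where "\<And>s. s \<ge> 1 + 2 * real p ^ 2 \<Longrightarrow> s ^ p * (y s)\<^sup>2 \<le> C"
proof -
  define E where "E s = (y s)\<^sup>2 + 4 * s * (y' s)\<^sup>2 + 4 * p * y s * y' s" for s
  define K where "K = 2 * p * (D - 2 * p)"
  \<comment> \<open>\<open>K\<close> is the coefficient of the product \<open>y s * y' s\<close>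
    that survives the cancellation. Completing the square against
    \<open>4 * s * (y' s)\<^sup>2\<close> leaves
    \<open>K\<^sup>2 / (16 * s) * (y s)\<^sup>2\<close>, at most \<open>c / s * E s\<close>. The
    logarithmic derivative \<open>- c / s\<^sup>2\<close> of \<open>exp (c / s)\<close> absorbs
    this, and the factor stays bounded for large \<open>s\<close>.\<close>
  define c where "c = K\<^sup>2 / 8"
  define H where "H s = s ^ p * E s * exp (c / s)" for s
  \<comment> \<open>From here on \<open>4 * s \<ge> 8 * p\<^sup>2\<close>, so that
    \<open>E s - (y s)\<^sup>2 / 2\<close> dominates the square
    \<open>(y s + 4 * p * y' s)\<^sup>2 / 2\<close>. The summand 1 keeps the threshold positive for
    \<open>p = 0\<close>.\<close>
  define s1 where "s1 = 1 + 2 * real p ^ 2"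
  have s1: "s1 > 0" unfolding s1_def by (simp add: add_pos_nonneg)
  have E_ge: "E s \<ge> (y s)\<^sup>2 / 2" if "s \<ge> s1" for s
  proof -
    have "8 * (real p)\<^sup>2 * (y' s)\<^sup>2 \<le> 4 * s * (y' s)\<^sup>2"
      using that by (intro mult_right_mono) (auto simp: s1_def)
    moreover have "0 \<le> (y s + 4 * p * y' s)\<^sup>2 / 2" by simp
    ultimately show ?thesis
      unfolding E_def by (simp add: power2_eq_square algebra_simps)
  qed
  have H': "(H has_real_derivative
      s ^ p / s * (4 * (2 * p + 1 - D) * s * (y' s)\<^sup>2 - K * y s * y' s - c * E s / s) * exp (c / s)) (at s)"
    if "s > 0" for s
  proof -
    have pw: "((\<lambda>s. s ^ p) has_real_derivative p * (s ^ p / s)) (at s)"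
    proof -
      have "p * (s ^ p / s) = p * s ^ (p - 1)" using that by (cases p) auto
      then show ?thesis using DERIV_pow[of p s UNIV] by simp
    qed
    have E': "(E has_real_derivative 2 * y s * y' s + 4 * (y' s)\<^sup>2 + 8 * s * y' s * y'' s
        + 4 * p * (y' s)\<^sup>2 + 4 * p * y s * y'' s) (at s)"
      unfolding E_def
      by (rule derivative_eq_intros y[OF that] y'[OF that] refl)+ (simp add: power2_eq_square algebra_simps)
    have ex: "((\<lambda>s. exp (c / s)) has_real_derivative - (c / s / s) * exp (c / s)) (at s)"
      using that by (auto intro!: derivative_eq_intros simp: field_simps power2_eq_square)
    \<comment> \<open>The multiplier \<open>2 * s * y' s + p * y s\<close> of the equation is read
      off from the terms containing \<open>y'' s\<close>.\<close>
    have "p * E s + s * (2 * y s * y' s + 4 * (y' s)\<^sup>2 + 8 * s * y' s * y'' s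
        + 4 * p * (y' s)\<^sup>2 + 4 * p * y s * y'' s)
      = 4 * (2 * p + 1 - D) * s * (y' s)\<^sup>2 - K * y s * y' s
        + (2 * s * y' s + p * y s) * (4 * s * y'' s + 2 * D * y' s + y s)"
      unfolding E_def K_def by (simp add: power2_eq_square algebra_simps)
    then have eq: "p * E s + s * (2 * y s * y' s + 4 * (y' s)\<^sup>2 + 8 * s * y' s * y'' s
        + 4 * p * (y' s)\<^sup>2 + 4 * p * y s * y'' s)
      = 4 * (2 * p + 1 - D) * s * (y' s)\<^sup>2 - K * y s * y' s"
      using ode[OF that] by simp
    show ?thesis
      unfolding H_def
      apply (rule DERIV_cong[OF DERIV_mult[OF DERIV_mult[OF pw E'] ex]])
      unfolding eq[symmetric] using that by (simp add: field_simps)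
  qed
  have "H s \<le> H s1" if "s \<ge> s1" for s
  proof (rule DERIV_nonpos_imp_nonincreasing[OF that])
    fix x assume x: "s1 \<le> x" "x \<le> s"
    then have x0: "x > 0" using s1 by simp
    \<comment> \<open>The hypothesis on \<open>D\<close> makes \<open>2 * p + 1 - D\<close> at most
      -1; the resulting \<open>- 4 * x * (y' x)\<^sup>2\<close> pays for the square completed
      next.\<close>
    have "4 * (2 * p + 1 - D) * x * (y' x)\<^sup>2 \<le> - 4 * x * (y' x)\<^sup>2"
      using D x0 by (intro mult_right_mono) auto
    moreover have "- K * y x * y' x \<le> 4 * x * (y' x)\<^sup>2 + c / x * ((y x)\<^sup>2 / 2)"
    proof -
      have "0 \<le> (2 * x * y' x + K * y x / 4)\<^sup>2 / x" using x0 by simp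
      also have "\<dots> = 4 * x * (y' x)\<^sup>2 + c / x * ((y x)\<^sup>2 / 2) + K * y x * y' x"
        using x0 by (simp add: c_def power2_eq_square field_simps)
      finally show ?thesis by simp
    qed
    moreover have "c / x * ((y x)\<^sup>2 / 2) \<le> c / x * E x"
      using E_ge[OF x(1)] x0 by (intro mult_left_mono) (auto simp: c_def)
    ultimately have "4 * (2 * p + 1 - D) * x * (y' x)\<^sup>2 - K * y x * y' x - c * E x / x \<le> 0"
      by simp
    then have "x ^ p / x * (4 * (2 * p + 1 - D) * x * (y' x)\<^sup>2 - K * y x * y' x - c * E x / x) * exp (c / x) \<le> 0"
      using x0 by (intro mult_nonpos_nonneg mult_nonneg_nonpos) auto
    with H'[OF x0] show "\<exists>y. (H has_real_derivative y) (at x) \<and> y \<le> 0" by blast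
  qed
  moreover have "s ^ p * (y s)\<^sup>2 \<le> 2 * H s" if "s \<ge> s1" for s
  proof -
    have "s > 0" using that s1 by simp
    have "s ^ p * ((y s)\<^sup>2 / 2) * 1 \<le> s ^ p * E s * exp (c / s)"
      using E_ge[OF that] \<open>s > 0\<close> order_trans[OF _ E_ge[OF that], of 0]
      by (intro mult_mono mult_left_mono) (auto simp: c_def)
    then show ?thesis by (simp add: H_def)
  qed
  ultimately have "s ^ p * (y s)\<^sup>2 \<le> 2 * H s1" if "s \<ge> s1" for s
    using that by (smt (verit))
  then show thesis using that unfolding s1_def by blast
qed

text \<open>The energy estimate covers large \<open>s\<close> only. On the remaining interval next
  to 0 the recursion is singular, but multiplied by \<open>s ^ Suc j\<close> it expresses each
  weighted term through the two preceding ones with bounded coefficients.\<close>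

lemma bessel_sequence_bounded:
  fixes \<kappa> :: "nat \<Rightarrow> real \<Rightarrow> real" and d m :: nat
  assumes deriv: "\<And>n s. s > 0 \<Longrightarrow> (\<kappa> n has_real_derivative \<kappa> (Suc n) s) (at s)"
    and rec: "\<And>n s. s > 0 \<Longrightarrow> 4 * s * \<kappa> (Suc (Suc n)) s + (2 * d + 4 * n) * \<kappa> (Suc n) s + \<kappa> n s = 0"
    and 0: "\<And>s. s > 0 \<Longrightarrow> \<bar>\<kappa> 0 s\<bar> \<le> 1"
    and 1: "\<And>s. s > 0 \<Longrightarrow> \<bar>s * \<kappa> 1 s\<bar> \<le> sqrt s"
    and d: "d \<ge> 2 * m + 2" and n: "n \<le> m"
  obtains C where "\<And>s. s > 0 \<Longrightarrow> \<bar>s ^ n * \<kappa> n s\<bar> \<le> C"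
proof -
  define s1 :: real where "s1 = 1 + 2 * real (m + n) ^ 2"
  have s1: "s1 \<ge> 1" by (simp add: s1_def)
  \<comment> \<open>Two consecutive terms are bounded together because the recursion has three
    terms.\<close>
  have near: "\<exists>C. \<forall>s. 0 < s \<and> s \<le> s1 \<longrightarrow> \<bar>s ^ j * \<kappa> j s\<bar> \<le> C \<and> \<bar>s ^ Suc j * \<kappa> (Suc j) s\<bar> \<le> C" for j
  proof (induction j)
    case 0
    have "\<bar>\<kappa> 0 s\<bar> \<le> s1 \<and> \<bar>s * \<kappa> 1 s\<bar> \<le> s1" if "0 < s" "s \<le> s1" for s
    proof -
      have "sqrt s \<le> sqrt s1" using that by simp
      also have "\<dots> \<le> s1" using s1 by (intro real_le_lsqrt) (auto simp: power2_eq_square)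
      finally show ?thesis using assms(3,4)[OF that(1)] s1 by auto
    qed
    then show ?case by (intro exI[of _ s1]) auto
  next
    case (Suc j)
    then obtain C where C: "\<And>s. 0 < s \<Longrightarrow> s \<le> s1 \<Longrightarrow> \<bar>s ^ j * \<kappa> j s\<bar> \<le> C \<and> \<bar>s ^ Suc j * \<kappa> (Suc j) s\<bar> \<le> C"
      by blast
    define C' where "C' = (2 * d + 4 * j) * C + s1 * C"
    have "\<bar>s ^ Suc (Suc j) * \<kappa> (Suc (Suc j)) s\<bar> \<le> C'" if s: "0 < s" "s \<le> s1" for s
    proof -
      have "4 * (s ^ Suc (Suc j) * \<kappa> (Suc (Suc j)) s) =
          - ((2 * d + 4 * j) * (s ^ Suc j * \<kappa> (Suc j) s) + s * (s ^ j * \<kappa> j s))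
          + s ^ Suc j * (4 * s * \<kappa> (Suc (Suc j)) s + (2 * d + 4 * j) * \<kappa> (Suc j) s + \<kappa> j s)"
        by (simp add: algebra_simps)
      also have "\<dots> = - ((2 * d + 4 * j) * (s ^ Suc j * \<kappa> (Suc j) s) + s * (s ^ j * \<kappa> j s))"
        using rec[OF s(1), of j] by simp
      finally have "4 * \<bar>s ^ Suc (Suc j) * \<kappa> (Suc (Suc j)) s\<bar> =
          \<bar>(2 * d + 4 * j) * (s ^ Suc j * \<kappa> (Suc j) s) + s * (s ^ j * \<kappa> j s)\<bar>"
        by linarith
      also have "\<dots> \<le> (2 * d + 4 * j) * \<bar>s ^ Suc j * \<kappa> (Suc j) s\<bar> + s * \<bar>s ^ j * \<kappa> j s\<bar>"
        using s by (intro order_trans[OF abs_triangle_ineq]) (simp add: abs_mult)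
      also have "\<dots> \<le> C'"
        unfolding C'_def using C[OF s] s by (intro add_mono mult_mono) auto
      finally show ?thesis by linarith
    qed
    then show ?case using C by (intro exI[of _ "max C C'"]) (auto simp: le_max_iff_disj)
  qed
  then obtain C1 where C1: "\<And>s. 0 < s \<Longrightarrow> s \<le> s1 \<Longrightarrow> \<bar>s ^ n * \<kappa> n s\<bar> \<le> C1" by blast
  have D: "real (d + 2 * n) \<ge> 2 * real (m + n) + 2" using d by simp
  have rec': "4 * s * \<kappa> (Suc (Suc n)) s + 2 * real (d + 2 * n) * \<kappa> (Suc n) s + \<kappa> n s = 0" if "s > 0" for s
    using rec[OF that, of n] by simp
  obtain C2 where C2: "\<And>s. s \<ge> s1 \<Longrightarrow> s ^ (m + n) * (\<kappa> n s)\<^sup>2 \<le> C2"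
    using bessel_energy_bound[OF deriv deriv rec' D] unfolding s1_def by blast
  have "\<bar>s ^ n * \<kappa> n s\<bar> \<le> sqrt C2" if "s \<ge> s1" for s
  proof -
    have "(s ^ n * \<kappa> n s)\<^sup>2 = s ^ (n + n) * (\<kappa> n s)\<^sup>2"
      by (simp add: power_mult_distrib power_add power2_eq_square)
    also have "\<dots> \<le> s ^ (m + n) * (\<kappa> n s)\<^sup>2"
      using n that s1 by (intro mult_right_mono power_increasing) auto
    also have "\<dots> \<le> C2" by (rule C2[OF that])
    finally show ?thesis using real_le_rsqrt[of "\<bar>s ^ n * \<kappa> n s\<bar>"] by simp
  qed
  then have "\<bar>s ^ n * \<kappa> n s\<bar> \<le> max C1 (sqrt C2)" if "s > 0" for s
    using C1[OF that] by (cases "s \<le> s1") (auto simp: le_max_iff_disj)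
  then show thesis using that by blast
qed

text \<open>If \<open>k\<close> solves Bessel's equation for dimension \<open>d\<close>, these are the successive derivatives of
  \<open>s \<mapsto> k (sqrt s)\<close>. In the variable \<open>s\<close> differentiation raises the dimension
  by two, hence the three-term recursion.\<close>
fun bessel_seq :: "nat \<Rightarrow> (real \<Rightarrow> real) \<Rightarrow> (real \<Rightarrow> real) \<Rightarrow> nat \<Rightarrow> real \<Rightarrow> real" where
  "bessel_seq d k k' 0 s = k (sqrt s)"
| "bessel_seq d k k' (Suc 0) s = k' (sqrt s) / (2 * sqrt s)"
| "bessel_seq d k k' (Suc (Suc n)) s =
     - ((2 * d + 4 * n) * bessel_seq d k k' (Suc n) s + bessel_seq d k k' n s) / (4 * s)"

lemma bessel_seq_rec:
  "s > 0 \<Longrightarrow> 4 * s * bessel_seq d k k' (Suc (Suc n)) s + (2 * d + 4 * n) * bessel_seq d k k' (Suc n) s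
     + bessel_seq d k k' n s = 0"
  by simp

text \<open>The sequence is defined by the recursion, not by differentiation, so this has to be
  checked. Once it holds for the first two terms, differentiating the recursion at one index
  reproduces it at the next.\<close>

lemma bessel_seq_has_derivative:
  assumes k: "\<And>u. u > 0 \<Longrightarrow> (k has_real_derivative k' u) (at u)"
    and k': "\<And>u. u > 0 \<Longrightarrow> (k' has_real_derivative k'' u) (at u)"
    and ode: "\<And>u. u > 0 \<Longrightarrow> u * k'' u + (real d - 1) * k' u + u * k u = 0"
    and "s > 0"
  shows "(bessel_seq d k k' n has_real_derivative bessel_seq d k k' (Suc n) s) (at s)"
  using \<open>s > 0\<close>
proof (induction n rule: induct_nat_012)
  case 0
  then have "((\<lambda>s. k (sqrt s)) has_real_derivative k' (sqrt s) * (inverse (sqrt s) / 2)) (at s)"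
    by (intro DERIV_chain'[OF DERIV_real_sqrt k]) auto
  moreover have "k' (sqrt s) * (inverse (sqrt s) / 2) = k' (sqrt s) / (2 * sqrt s)"
    by (simp add: field_simps)
  moreover have "bessel_seq d k k' 0 = (\<lambda>s. k (sqrt s))" by (rule ext) simp
  ultimately show ?case by (simp only: bessel_seq.simps(2))
next
  \<comment> \<open>This is the only case that uses Bessel's equation: it rewrites
    \<open>k''\<close> in the derivative of \<open>k' (sqrt s) / (2 * sqrt s)\<close>.\<close>
  case 1
  define u where "u = sqrt s"
  have u: "u > 0" "s = u * u" using 1 by (auto simp: u_def)
  have sqrt': "(sqrt has_real_derivative inverse u / 2) (at s)"
    using DERIV_real_sqrt[OF 1] by (simp add: u_def)
  have k_sqrt: "((\<lambda>s. k' (sqrt s)) has_real_derivative k'' u * (inverse u / 2)) (at s)"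
    by (rule DERIV_chain'[OF sqrt']) (use k'[OF u(1)] in \<open>simp add: u_def\<close>)
  have "2 * sqrt s \<noteq> 0" using 1 by simp
  from DERIV_divide[OF k_sqrt DERIV_cmult[OF sqrt'] this]
  have "((\<lambda>s. k' (sqrt s) / (2 * sqrt s)) has_real_derivative
      (k'' u * (inverse u / 2) * (2 * u) - k' u * (2 * (inverse u / 2))) / (2 * u * (2 * u))) (at s)"
    by (simp only: u_def)
  moreover have "(k'' u * (inverse u / 2) * (2 * u) - k' u * (2 * (inverse u / 2))) / (2 * u * (2 * u))
      = bessel_seq d k k' (Suc (Suc 0)) s"
  proof -
    have k'': "k'' u = - ((real d - 1) * k' u / u + k u)"
      using ode[OF u(1)] u(1) by (simp add: field_simps)
    have "bessel_seq d k k' (Suc (Suc 0)) s = - (2 * d * (k' u / (2 * u)) + k u) / (4 * (u * u))"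
      using u(2) by (simp add: u_def)
    also have "\<dots> = (k'' u * (inverse u / 2) * (2 * u) - k' u * (2 * (inverse u / 2))) / (2 * u * (2 * u))"
      unfolding k'' using u(1) by (simp add: divide_simps) (simp add: algebra_simps)
    finally show ?thesis ..
  qed
  moreover have "bessel_seq d k k' (Suc 0) = (\<lambda>s. k' (sqrt s) / (2 * sqrt s))" by (rule ext) simp
  ultimately show ?case by (simp only:)
next
  \<comment> \<open>The numerator equals \<open>4 * s * ?b (Suc (Suc n)) s\<close>, so
    differentiating the denominator adds 4 to the coefficient \<open>2 * d + 4 * n\<close>, giving
    the one for \<open>Suc n\<close>.\<close>
  case (ge2 n)
  let ?b = "bessel_seq d k k'"
  have "((\<lambda>s. - ((2 * d + 4 * n) * ?b (Suc n) s + ?b n s) / (4 * s)) has_real_derivative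
      ((- ((2 * d + 4 * n) * ?b (Suc (Suc n)) s + ?b (Suc n) s)) * (4 * s)
        - (- ((2 * d + 4 * n) * ?b (Suc n) s + ?b n s)) * 4) / (4 * s * (4 * s))) (at s)"
    using ge2(3) by (intro DERIV_divide DERIV_minus DERIV_add DERIV_cmult ge2)
      (auto intro!: derivative_eq_intros)
  moreover have "((- ((2 * d + 4 * n) * ?b (Suc (Suc n)) s + ?b (Suc n) s)) * (4 * s)
        - (- ((2 * d + 4 * n) * ?b (Suc n) s + ?b n s)) * 4) / (4 * s * (4 * s)) = ?b (Suc (Suc (Suc n))) s"
  proof -
    have *: "- ((2 * d + 4 * n) * ?b (Suc n) s + ?b n s) = 4 * s * ?b (Suc (Suc n)) s"
      using ge2(3) by simp
    show ?thesis
      unfolding * bessel_seq.simps(3)[of d k k' "Suc n"]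
      using ge2(3) by (simp add: field_simps del: bessel_seq.simps)
  qed
  moreover have "?b (Suc (Suc n)) = (\<lambda>s. - ((2 * d + 4 * n) * ?b (Suc n) s + ?b n s) / (4 * s))"
    by (rule ext) simp
  ultimately show ?case by (simp only:)
qed

lemma borel_measurable_bessel_seq:
  assumes [measurable]: "k \<in> borel_measurable borel" "k' \<in> borel_measurable borel"
  shows "bessel_seq d k k' n \<in> borel_measurable borel"
proof (induction n rule: induct_nat_012)
  case (ge2 n)
  note [measurable] = ge2
  have "bessel_seq d k k' (Suc (Suc n)) =
      (\<lambda>s. - ((2 * d + 4 * n) * bessel_seq d k k' (Suc n) s + bessel_seq d k k' n s) / (4 * s))"
    by (rule ext) simp
  then show ?case by simp
qed (auto simp: measurable_cong[OF bessel_seq.simps(1)] measurable_cong[OF bessel_seq.simps(2)])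

section \<open>Orthogonal invariance of Lebesgue measure\<close>

lemma translation_invariant_eq_lborel:
  fixes \<mu> :: "'a::euclidean_space measure"
  assumes sets[measurable_cong]: "sets \<mu> = sets borel" and "sigma_finite_measure \<mu>"
    and transl: "\<And>c. distr \<mu> borel ((+) c) = \<mu>"
    and [measurable]: "B \<in> sets borel" and B: "emeasure lborel B = emeasure \<mu> (uminus -` B)"
    and B0: "emeasure lborel B \<noteq> 0" "emeasure lborel B \<noteq> \<infinity>"
  shows "\<mu> = lborel"
proof (rule measure_eqI)
  show "sets \<mu> = sets lborel" using sets by simp
  fix A assume "A \<in> sets \<mu>"
  then have [measurable]: "A \<in> sets borel" using sets by simp
  interpret \<mu>: sigma_finite_measure \<mu> by fact
  interpret P: pair_sigma_finite \<mu> lborel ..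
  have \<mu>_transl: "(\<integral>\<^sup>+x. f (c + x) \<partial>\<mu>) = (\<integral>\<^sup>+x. f x \<partial>\<mu>)"
    if [measurable]: "f \<in> borel_measurable borel" for f c
    by (subst (2) transl[of c, symmetric]) (simp add: nn_integral_distr)
  have l_transl: "(\<integral>\<^sup>+x. f (c + x) \<partial>lborel) = (\<integral>\<^sup>+x. f x \<partial>lborel)"
    if [measurable]: "f \<in> borel_measurable borel" for f and c :: 'a
    by (subst (2) lborel_distr_plus[of c, symmetric]) (simp add: nn_integral_distr)
  have "emeasure lborel B * emeasure \<mu> A = (\<integral>\<^sup>+y. indicator B y * emeasure \<mu> A \<partial>lborel)"
    by (simp add: nn_integral_multc)
  also have "\<dots> = (\<integral>\<^sup>+y. (\<integral>\<^sup>+x. indicator B y * indicator A (y + x) \<partial>\<mu>) \<partial>lborel)"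
    using \<mu>_transl[of "indicator A"] by (simp add: nn_integral_cmult sets)
  also have "\<dots> = (\<integral>\<^sup>+x. (\<integral>\<^sup>+y. indicator B y * indicator A (y + x) \<partial>lborel) \<partial>\<mu>)"
    by (rule P.Fubini') measurable
  also have "\<dots> = (\<integral>\<^sup>+x. (\<integral>\<^sup>+y. indicator B (y - x) * indicator A y \<partial>lborel) \<partial>\<mu>)"
  proof (rule nn_integral_cong)
    fix x :: 'a
    show "(\<integral>\<^sup>+y. indicator B y * indicator A (y + x) \<partial>lborel) =
        (\<integral>\<^sup>+y. indicator B (y - x) * indicator A y \<partial>lborel)"
      using l_transl[of "\<lambda>y. indicator B (y - x) * indicator A y" x] by (simp add: add.commute)
  qed
  also have "\<dots> = (\<integral>\<^sup>+y. (\<integral>\<^sup>+x. indicator B (y - x) * indicator A y \<partial>\<mu>) \<partial>lborel)"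
    by (rule P.Fubini'[symmetric]) measurable
  also have "\<dots> = (\<integral>\<^sup>+y. emeasure \<mu> (uminus -` B) * indicator A y \<partial>lborel)"
  proof (rule nn_integral_cong)
    fix y :: 'a
    have [measurable]: "uminus -` B \<in> sets borel"
      using measurable_sets[OF borel_measurable_uminus[OF measurable_ident] \<open>B \<in> sets borel\<close>]
      by simp
    have "(\<integral>\<^sup>+x. indicator B (y - x) \<partial>\<mu>) = (\<integral>\<^sup>+x. indicator B (- x) \<partial>\<mu>)"
      using \<mu>_transl[of "\<lambda>x. indicator B (y - x)" y] by simp
    also have "\<dots> = (\<integral>\<^sup>+x. indicator (uminus -` B) x \<partial>\<mu>)"
      by (simp add: indicator_def)
    also have "\<dots> = emeasure \<mu> (uminus -` B)" by (simp add: sets)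
    finally show "(\<integral>\<^sup>+x. indicator B (y - x) * indicator A y \<partial>\<mu>) = emeasure \<mu> (uminus -` B) * indicator A y"
      by (simp add: nn_integral_multc)
  qed
  also have "\<dots> = emeasure lborel B * emeasure lborel A"
    by (simp add: nn_integral_cmult B)
  finally show "emeasure \<mu> A = emeasure lborel A"
    using B0 by (simp add: ennreal_mult_cancel_left)
qed

lemma orthogonal_transformation_measurable:
  fixes Q :: "'a::euclidean_space \<Rightarrow> 'a"
  shows "orthogonal_transformation Q \<Longrightarrow> Q \<in> borel_measurable borel"
  by (intro borel_measurable_continuous_onI linear_continuous_on
      linear_conv_bounded_linear[THEN iffD1] orthogonal_transformation_linear)

text \<open>The image measure is again translation invariant, and the unit ball, fixed by
  \<open>Q\<close> and by negation, serves as normalising set.\<close>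

lemma distr_lborel_orthogonal:
  fixes Q :: "'a::euclidean_space \<Rightarrow> 'a"
  assumes Q: "orthogonal_transformation Q"
  shows "distr lborel borel Q = lborel"
proof (rule translation_invariant_eq_lborel[where B = "ball 0 1"])
  note [measurable] = orthogonal_transformation_measurable[OF Q]
  have ball: "Q -` ball 0 r = ball 0 r" for r
    using orthogonal_transformation_norm[OF Q] by auto
  have m_ball: "emeasure (distr lborel borel Q) (ball 0 r) = emeasure lborel (ball (0::'a) r)" for r
    by (simp add: emeasure_distr ball)
  show "sigma_finite_measure (distr lborel borel Q)"
  proof
    show "\<exists>A. countable A \<and> A \<subseteq> sets (distr lborel borel Q) \<and> \<Union> A = space (distr lborel borel Q)
        \<and> (\<forall>a\<in>A. emeasure (distr lborel borel Q) a \<noteq> \<infinity>)"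
    proof (intro exI[of _ "range (\<lambda>n::nat. ball 0 (real n))"] conjI ballI)
      show "\<Union> (range (\<lambda>n::nat. ball 0 (real n))) = space (distr lborel borel Q)"
        by (auto simp: reals_Archimedean2)
      show "emeasure (distr lborel borel Q) a \<noteq> \<infinity>" if "a \<in> range (\<lambda>n::nat. ball 0 (real n))" for a
        using that
        by (auto simp: m_ball emeasure_lborel_ball_finite[THEN less_imp_neq, unfolded infinity_ennreal_def])
    qed auto
  qed
  show "distr (distr lborel borel Q) borel ((+) c) = distr lborel borel Q" for c
  proof -
    \<comment> \<open>Translation by \<open>c\<close> after \<open>Q\<close> is translation by
      \<open>b\<close> before \<open>Q\<close>.\<close>
    obtain b where b: "Q b = c" using orthogonal_transformation_surj[OF Q] by (metis surjD)
    have "distr (distr lborel borel Q) borel ((+) c) = distr lborel borel (\<lambda>x. Q (b + x))"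
      by (simp add: distr_distr o_def linear_add[OF orthogonal_transformation_linear[OF Q]] b)
    also have "\<dots> = distr (distr lborel borel ((+) b)) borel Q"
      by (simp add: distr_distr o_def)
    finally show ?thesis by (simp add: lborel_distr_plus)
  qed
  have "uminus -` ball 0 1 = (ball 0 1 :: 'a set)" by auto
  then show "emeasure lborel (ball 0 1 :: 'a set) = emeasure (distr lborel borel Q) (uminus -` ball 0 1)"
    by (simp add: m_ball)
  show "emeasure lborel (ball 0 1 :: 'a set) \<noteq> 0" "emeasure lborel (ball 0 1 :: 'a set) \<noteq> \<infinity>"
    using emeasure_lborel_ball_finite[of "0::'a" 1] open_not_negligible[of "ball (0::'a) 1"]
    by (auto simp: negligible_iff_null_sets null_sets_def)
qed auto

text \<open>The transform integrates over \<open>lebesgue\<close>, and \<open>\<Phi>\<close> is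
  measurable only for the completion, so the invariance must be carried over to it.\<close>

lemma distr_lebesgue_orthogonal:
  fixes Q :: "'a::euclidean_space \<Rightarrow> 'a"
  assumes Q: "orthogonal_transformation Q"
  shows "Q \<in> lebesgue \<rightarrow>\<^sub>M lebesgue" "distr lebesgue lebesgue Q = lebesgue"
proof -
  have m: "Q \<in> lborel \<rightarrow>\<^sub>M lborel" using orthogonal_transformation_measurable[OF Q] by simp
  then have "distr lebesgue lborel Q = distr lborel borel Q"
    by (simp add: distr_completion cong: distr_cong)
  also have "\<dots> = lborel" by (rule distr_lborel_orthogonal[OF Q])
  finally have eq: "distr lebesgue lborel Q = lborel" .
  show "Q \<in> lebesgue \<rightarrow>\<^sub>M lebesgue"
    using m by (simp add: completion.measurable_completion2 eq measurable_completion)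
  show "distr lebesgue lebesgue Q = lebesgue"
    using completion.completion_distr_eq[OF measurable_completion[OF m]] by (simp add: eq)
qed

section \<open>The Fourier transform of the sphere\<close>

text \<open>Projecting the uniform distribution on the ball radially lets the measure inherit
  rotation invariance from \<open>lborel\<close>. As \<open>sgn 0 = 0\<close>, it lives on the
  sphere only up to a null set, hence the almost-everywhere statements below.\<close>

definition sphere_measure :: "(real ^ 'n) measure" where
  "sphere_measure = distr (uniform_measure lborel (ball 0 1)) borel sgn"

lemma borel_measurable_sgn_vector [measurable]:
  "(sgn :: real ^ 'n \<Rightarrow> real ^ 'n) \<in> borel_measurable borel"
  unfolding sgn_div_norm[abs_def] by measurable

lemma sets_sphere_measure [simp, measurable_cong]: "sets sphere_measure = sets borel"
  and space_sphere_measure [simp]: "space sphere_measure = UNIV"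
  by (simp_all add: sphere_measure_def)

lemma emeasure_unit_ball:
  "emeasure lborel (ball 0 1 :: (real ^ 'n) set) \<noteq> 0"
  "emeasure lborel (ball 0 1 :: (real ^ 'n) set) < \<infinity>"
  using emeasure_lborel_ball_finite[of "0::real^'n" 1] open_not_negligible[of "ball (0::real^'n) 1"]
  by (auto simp: negligible_iff_null_sets null_sets_def)

lemma emeasure_sphere_measure_UNIV: "emeasure sphere_measure UNIV = 1"
  by (simp add: sphere_measure_def emeasure_distr ennreal_divide_self emeasure_unit_ball
      emeasure_unit_ball(2)[unfolded infinity_ennreal_def])

lemma finite_measure_sphere_measure: "finite_measure sphere_measure"
  by (rule finite_measureI) (simp add: emeasure_sphere_measure_UNIV)

lemma measure_sphere_measure_UNIV: "measure sphere_measure UNIV = 1"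
  by (simp add: measure_def emeasure_sphere_measure_UNIV)

lemma AE_sphere_measure: "AE \<omega> in sphere_measure. norm \<omega> = 1"
proof -
  have "AE x in lborel. (x::real^'n) \<noteq> 0" by (rule AE_lborel_singleton)
  then have "AE x in lborel. x \<in> ball 0 1 \<longrightarrow> norm (sgn (x::real^'n)) = 1"
    by eventually_elim (simp add: norm_sgn)
  then have "AE x in uniform_measure lborel (ball 0 1). norm (sgn (x::real^'n)) = 1"
    by (intro AE_uniform_measureI) auto
  then show ?thesis unfolding sphere_measure_def by (subst AE_distr_iff) auto
qed

lemma distr_sphere_measure_orthogonal:
  fixes Q :: "real ^ 'n \<Rightarrow> real ^ 'n"
  assumes Q: "orthogonal_transformation Q"
  shows "distr sphere_measure borel Q = sphere_measure"
proof -
  note [measurable] = orthogonal_transformation_measurable[OF Q]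
  let ?U = "uniform_measure lborel (ball 0 1) :: (real ^ 'n) measure"
  have U: "distr ?U borel Q = ?U"
  proof (rule measure_eqI)
    fix A assume "A \<in> sets (distr ?U borel Q)"
    then have [measurable]: "A \<in> sets borel" by simp
    have QA [measurable]: "Q -` A \<in> sets borel"
      using measurable_sets[OF orthogonal_transformation_measurable[OF Q], of A] by simp
    have "Q -` (ball 0 1 \<inter> A) = ball 0 1 \<inter> Q -` A"
      using orthogonal_transformation_norm[OF Q] by auto
    then have "emeasure lborel (ball 0 1 \<inter> Q -` A) = emeasure (distr lborel borel Q) (ball 0 1 \<inter> A)"
      by (simp add: emeasure_distr)
    then show "emeasure (distr ?U borel Q) A = emeasure ?U A"
      by (simp add: emeasure_distr distr_lborel_orthogonal[OF Q])
  qed simp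
  have "Q (sgn x) = sgn (Q x)" for x
    by (simp add: sgn_div_norm orthogonal_transformation_norm[OF Q]
        linear_scale[OF orthogonal_transformation_linear[OF Q]])
  then have "distr sphere_measure borel Q = distr (distr ?U borel Q) borel sgn"
    by (simp add: sphere_measure_def distr_distr o_def)
  then show ?thesis by (simp add: U sphere_measure_def)
qed

lemma integrable_sphere_measure:
  fixes f :: "real ^ 'n \<Rightarrow> 'b::{banach, second_countable_topology}"
  assumes "f \<in> borel_measurable borel" "\<And>\<omega>. norm \<omega> = 1 \<Longrightarrow> norm (f \<omega>) \<le> B"
  shows "integrable sphere_measure f"
proof -
  interpret finite_measure "sphere_measure :: (real^'n) measure" by (rule finite_measure_sphere_measure)
  show ?thesis
    using AE_sphere_measure assms(1)
    by (intro integrable_const_bound[of _ B]) (auto intro: assms(2) elim: eventually_mono)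
qed

section \<open>Cosine integrals over the sphere and Bessel's equation\<close>

lemma integral_sphere_measure_cos_cong:
  fixes a b :: "real ^ 'n"
  assumes "norm a = norm b"
  shows "(\<integral>\<omega>. cos (a \<bullet> \<omega>) \<partial>sphere_measure) = (\<integral>\<omega>. cos (b \<bullet> \<omega>) \<partial>sphere_measure)"
proof -
  obtain Q where Q: "orthogonal_transformation Q" "Q a = b"
    using orthogonal_transformation_exists[OF assms] .
  note [measurable] = orthogonal_transformation_measurable[OF Q(1)]
  have "(\<integral>\<omega>. cos (b \<bullet> \<omega>) \<partial>sphere_measure) = (\<integral>\<omega>. cos (b \<bullet> \<omega>) \<partial>distr sphere_measure borel Q)"
    by (simp add: distr_sphere_measure_orthogonal[OF Q(1)])
  also have "\<dots> = (\<integral>\<omega>. cos (Q a \<bullet> Q \<omega>) \<partial>sphere_measure)"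
    by (simp add: integral_distr Q(2))
  also have "\<dots> = (\<integral>\<omega>. cos (a \<bullet> \<omega>) \<partial>sphere_measure)"
    using Q(1) by (simp add: orthogonal_transformation_def)
  finally show ?thesis ..
qed

text \<open>The Fourier transform of the sphere measure along the axis \<open>i\<close>, its sine
  part vanishing by symmetry. The value is the same for every coordinate by rotation invariance; the
  argument \<open>i\<close> also carries the dimension through its type.\<close>

definition sphere_kernel :: "'n::finite \<Rightarrow> real \<Rightarrow> real" where
  "sphere_kernel i u = (\<integral>\<omega>. cos (u * \<omega> $ i) \<partial>(sphere_measure :: (real ^ 'n) measure))"

definition sphere_kernel' :: "'n::finite \<Rightarrow> real \<Rightarrow> real" where
  "sphere_kernel' i u = (\<integral>\<omega>. - (\<omega> $ i) * sin (u * \<omega> $ i) \<partial>(sphere_measure :: (real ^ 'n) measure))"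

definition sphere_kernel'' :: "'n::finite \<Rightarrow> real \<Rightarrow> real" where
  "sphere_kernel'' i u = (\<integral>\<omega>. - (\<omega> $ i)\<^sup>2 * cos (u * \<omega> $ i) \<partial>(sphere_measure :: (real ^ 'n) measure))"

lemma integral_sphere_measure_cos:
  fixes a :: "real ^ 'n" and i :: 'n
  shows "(\<integral>\<omega>. cos (a \<bullet> \<omega>) \<partial>sphere_measure) = sphere_kernel i (norm a)"
  using integral_sphere_measure_cos_cong[of a "norm a *\<^sub>R axis i 1"]
  by (simp add: sphere_kernel_def inner_axis')

lemma integral_sphere_measure_le:
  fixes f :: "real ^ 'n \<Rightarrow> real"
  assumes [measurable]: "f \<in> borel_measurable borel" and "\<And>\<omega>. norm \<omega> = 1 \<Longrightarrow> \<bar>f \<omega>\<bar> \<le> 1"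
  shows "\<bar>\<integral>\<omega>. f \<omega> \<partial>sphere_measure\<bar> \<le> 1"
proof -
  interpret finite_measure "sphere_measure :: (real^'n) measure" by (rule finite_measure_sphere_measure)
  have i: "integrable sphere_measure f" using assms by (intro integrable_sphere_measure[of _ 1]) auto
  have "\<bar>\<integral>\<omega>. f \<omega> \<partial>sphere_measure\<bar> \<le> (\<integral>\<omega>. \<bar>f \<omega>\<bar> \<partial>sphere_measure)"
    by (rule integral_abs_bound)
  also have "\<dots> \<le> (\<integral>\<omega>. 1 \<partial>(sphere_measure :: (real^'n) measure))"
    using i AE_sphere_measure
    by (intro integral_mono_AE) (auto elim!: eventually_mono simp: assms(2))
  also have "\<dots> = 1" by (simp add: measure_sphere_measure_UNIV)
  finally show ?thesis .
qed

lemma abs_sphere_kernel_le: "\<bar>sphere_kernel i u\<bar> \<le> 1"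
  unfolding sphere_kernel_def by (rule integral_sphere_measure_le) auto

lemma abs_sphere_kernel'_le: "\<bar>sphere_kernel' i u\<bar> \<le> 1"
  unfolding sphere_kernel'_def
proof (rule integral_sphere_measure_le)
  fix \<omega> :: "real ^ 'a" assume "norm \<omega> = 1"
  then have "\<bar>\<omega> $ i\<bar> \<le> 1" using component_le_norm_cart[of \<omega> i] by simp
  then show "\<bar>- (\<omega> $ i) * sin (u * \<omega> $ i)\<bar> \<le> 1"
    by (simp add: abs_mult mult_le_one)
qed auto

lemma sphere_kernel_has_derivative:
  "(sphere_kernel i has_real_derivative sphere_kernel' i u) (at u)"
proof -
  have "((\<lambda>u. \<integral>\<omega>. cos (u * \<omega> $ i) \<partial>sphere_measure) has_vector_derivative
      (\<integral>\<omega>. - (\<omega> $ i) * sin (u * \<omega> $ i) \<partial>sphere_measure)) (at u)"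
  \<comment> \<open>The dominating function is \<open>norm\<close> rather than 1 because the bound
    is required on the whole space, not just on the sphere.\<close>
  proof (rule has_vector_derivative_integral[where a = "u - 1" and b = "u + 1" and w = norm])
    show "integrable sphere_measure (\<lambda>\<omega>::real^'a. cos (s * \<omega> $ i))" for s
      by (rule integrable_sphere_measure[of _ 1]) auto
    show "integrable sphere_measure (norm :: real^'a \<Rightarrow> real)"
      by (rule integrable_sphere_measure[of _ 1]) auto
    show "((\<lambda>s. cos (s * \<omega> $ i)) has_vector_derivative - (\<omega> $ i) * sin (s * \<omega> $ i)) (at s)"
      for s and \<omega> :: "real^'a"
      unfolding has_real_derivative_iff_has_vector_derivative[symmetric]
      by (auto intro!: derivative_eq_intros)
    show "norm (- (\<omega> $ i) * sin (s * \<omega> $ i)) \<le> norm \<omega>" for s and \<omega> :: "real^'a"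
    proof -
      have "\<bar>\<omega> $ i\<bar> * \<bar>sin (s * \<omega> $ i)\<bar> \<le> norm \<omega> * 1"
        by (intro mult_mono component_le_norm_cart) auto
      then show ?thesis by (simp add: abs_mult)
    qed
  qed auto
  then show ?thesis
    unfolding has_real_derivative_iff_has_vector_derivative sphere_kernel_def[abs_def] sphere_kernel'_def .
qed

lemma sphere_kernel'_has_derivative:
  "(sphere_kernel' i has_real_derivative sphere_kernel'' i u) (at u)"
proof -
  have "((\<lambda>u. \<integral>\<omega>. - (\<omega> $ i) * sin (u * \<omega> $ i) \<partial>sphere_measure) has_vector_derivative
      (\<integral>\<omega>. - (\<omega> $ i)\<^sup>2 * cos (u * \<omega> $ i) \<partial>sphere_measure)) (at u)"
  proof (rule has_vector_derivative_integral[where a = "u - 1" and b = "u + 1" and w = "\<lambda>\<omega>. (norm \<omega>)\<^sup>2"])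
    show "integrable sphere_measure (\<lambda>\<omega>::real^'a. - (\<omega> $ i) * sin (s * \<omega> $ i))" for s
    proof (rule integrable_sphere_measure[of _ 1])
      fix \<omega> :: "real ^ 'a" assume "norm \<omega> = 1"
      then have "\<bar>\<omega> $ i\<bar> \<le> 1" using component_le_norm_cart[of \<omega> i] by simp
      then show "norm (- (\<omega> $ i) * sin (s * \<omega> $ i)) \<le> 1"
        by (simp add: abs_mult mult_le_one)
    qed auto
    show "integrable sphere_measure (\<lambda>\<omega>::real^'a. (norm \<omega>)\<^sup>2)"
      by (rule integrable_sphere_measure[of _ 1]) auto
    show "((\<lambda>s. - (\<omega> $ i) * sin (s * \<omega> $ i)) has_vector_derivative - (\<omega> $ i)\<^sup>2 * cos (s * \<omega> $ i)) (at s)"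
      for s and \<omega> :: "real^'a"
      unfolding has_real_derivative_iff_has_vector_derivative[symmetric]
      by (auto intro!: derivative_eq_intros simp: power2_eq_square)
    show "norm (- (\<omega> $ i)\<^sup>2 * cos (s * \<omega> $ i)) \<le> (norm \<omega>)\<^sup>2" for s and \<omega> :: "real^'a"
    proof -
      have "\<bar>\<omega> $ i\<bar>\<^sup>2 * \<bar>cos (s * \<omega> $ i)\<bar> \<le> (norm \<omega>)\<^sup>2 * 1"
        by (intro mult_mono power_mono component_le_norm_cart) auto
      then show ?thesis by (simp add: abs_mult)
    qed
  qed auto
  then show ?thesis
    unfolding has_real_derivative_iff_has_vector_derivative sphere_kernel'_def[abs_def] sphere_kernel''_def .
qed

text \<open>Rotating \<open>u *\<^sub>R axis i 1\<close> by the angle \<open>\<theta>\<close> in the \<open>(i, j)\<close>-plane does not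
  change the integral; the identity is its second derivative at \<open>\<theta> = 0\<close>.\<close>
lemma sphere_kernel'_eq:
  fixes i j :: "'n::finite"
  assumes "i \<noteq> j"
  shows "u * sphere_kernel' i u = - u\<^sup>2 * (\<integral>\<omega>. (\<omega> $ j)\<^sup>2 * cos (u * \<omega> $ i) \<partial>sphere_measure)"
proof -
  let ?\<sigma> = "sphere_measure :: (real ^ 'n) measure"
  \<comment> \<open>\<open>z \<theta> \<omega>\<close> is the inner product of
    \<open>\<omega>\<close> with the rotated axis, and \<open>z'\<close> is its derivative in the
    angle.\<close>
  define z where "z \<theta> \<omega> = cos \<theta> * \<omega> $ i + sin \<theta> * \<omega> $ j" for \<theta> and \<omega> :: "real ^ 'n"
  define z' where "z' \<theta> \<omega> = - sin \<theta> * \<omega> $ i + cos \<theta> * \<omega> $ j" for \<theta> and \<omega> :: "real ^ 'n"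
  have [measurable]: "z \<theta> \<in> borel_measurable borel" "z' \<theta> \<in> borel_measurable borel" for \<theta>
    unfolding z_def[abs_def] z'_def[abs_def] by measurable
  have z_deriv: "((\<lambda>\<theta>. z \<theta> \<omega>) has_real_derivative z' \<theta> \<omega>) (at \<theta>)"
    and z'_deriv: "((\<lambda>\<theta>. z' \<theta> \<omega>) has_real_derivative - z \<theta> \<omega>) (at \<theta>)" for \<theta> \<omega>
    unfolding z_def z'_def by (auto intro!: derivative_eq_intros)
  have comb: "\<bar>a * \<omega> $ i + b * \<omega> $ j\<bar> \<le> 2 * norm \<omega>" if "\<bar>a\<bar> \<le> 1" "\<bar>b\<bar> \<le> 1" for a b and \<omega> :: "real ^ 'n"
  proof -
    have "\<bar>a\<bar> * \<bar>\<omega> $ i\<bar> \<le> 1 * norm \<omega>" "\<bar>b\<bar> * \<bar>\<omega> $ j\<bar> \<le> 1 * norm \<omega>"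
      using that by (intro mult_mono component_le_norm_cart; simp)+
    then show ?thesis by (simp add: abs_mult[symmetric])
  qed
  have z_le: "\<bar>z \<theta> \<omega>\<bar> \<le> 2 * norm \<omega>" and z'_le: "\<bar>z' \<theta> \<omega>\<bar> \<le> 2 * norm \<omega>" for \<theta> \<omega>
    unfolding z_def z'_def by (rule comb; simp)+
  have 0: "integrable ?\<sigma> (\<lambda>\<omega>. cos (u * z \<theta> \<omega>))" for \<theta>
    by (rule integrable_sphere_measure[of _ 1]) auto
  have bound1: "norm (- (u * z' \<theta> \<omega>) * sin (u * z \<theta> \<omega>)) \<le> 2 * \<bar>u\<bar> * norm \<omega>" for \<theta> \<omega>
  proof -
    have "\<bar>u\<bar> * \<bar>z' \<theta> \<omega>\<bar> * \<bar>sin (u * z \<theta> \<omega>)\<bar> \<le> \<bar>u\<bar> * (2 * norm \<omega>) * 1"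
      by (intro mult_mono z'_le) auto
    then show ?thesis by (simp add: abs_mult mult_ac)
  qed
  have 1: "integrable ?\<sigma> (\<lambda>\<omega>. - (u * z' \<theta> \<omega>) * sin (u * z \<theta> \<omega>))" for \<theta>
  proof (rule integrable_sphere_measure[of _ "2 * \<bar>u\<bar>"])
    show "norm (- (u * z' \<theta> \<omega>) * sin (u * z \<theta> \<omega>)) \<le> 2 * \<bar>u\<bar>" if "norm \<omega> = 1" for \<omega>
      using bound1[of \<theta> \<omega>] that by simp
  qed measurable
  have bound2: "norm (u * z \<theta> \<omega> * sin (u * z \<theta> \<omega>) - (u * z' \<theta> \<omega>)\<^sup>2 * cos (u * z \<theta> \<omega>))
      \<le> 2 * \<bar>u\<bar> * norm \<omega> + (2 * \<bar>u\<bar> * norm \<omega>)\<^sup>2" for \<theta> \<omega>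
  proof -
    have "\<bar>u\<bar> * \<bar>z \<theta> \<omega>\<bar> * \<bar>sin (u * z \<theta> \<omega>)\<bar> \<le> \<bar>u\<bar> * (2 * norm \<omega>) * 1"
      by (intro mult_mono z_le) auto
    moreover have "(\<bar>u\<bar> * \<bar>z' \<theta> \<omega>\<bar>)\<^sup>2 * \<bar>cos (u * z \<theta> \<omega>)\<bar> \<le> (\<bar>u\<bar> * (2 * norm \<omega>))\<^sup>2 * 1"
      by (intro mult_mono power_mono z'_le) auto
    ultimately show ?thesis
      unfolding real_norm_def
      by (intro order_trans[OF abs_triangle_ineq4] add_mono) (simp_all add: abs_mult mult_ac power_mult_distrib)
  qed
  have deriv1: "((\<lambda>\<theta>. \<integral>\<omega>. cos (u * z \<theta> \<omega>) \<partial>?\<sigma>) has_vector_derivative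
      (\<integral>\<omega>. - (u * z' \<theta> \<omega>) * sin (u * z \<theta> \<omega>) \<partial>?\<sigma>)) (at \<theta>)" for \<theta>
  proof (rule has_vector_derivative_integral[where a = "\<theta> - 1" and b = "\<theta> + 1" and w = "\<lambda>\<omega>. 2 * \<bar>u\<bar> * norm \<omega>"])
    show "((\<lambda>s. cos (u * z s \<omega>)) has_vector_derivative - (u * z' s \<omega>) * sin (u * z s \<omega>)) (at s)" for s \<omega>
      unfolding has_real_derivative_iff_has_vector_derivative[symmetric]
      by (auto intro!: derivative_eq_intros z_deriv)
    show "integrable ?\<sigma> (\<lambda>\<omega>. 2 * \<bar>u\<bar> * norm \<omega>)"
      by (rule integrable_sphere_measure[of _ "2 * \<bar>u\<bar>"]) auto
  qed (use 0 bound1 in auto)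
  have deriv2: "((\<lambda>\<theta>. \<integral>\<omega>. - (u * z' \<theta> \<omega>) * sin (u * z \<theta> \<omega>) \<partial>?\<sigma>) has_vector_derivative
      (\<integral>\<omega>. u * z \<theta> \<omega> * sin (u * z \<theta> \<omega>) - (u * z' \<theta> \<omega>)\<^sup>2 * cos (u * z \<theta> \<omega>) \<partial>?\<sigma>)) (at \<theta>)" for \<theta>
  proof (rule has_vector_derivative_integral[where a = "\<theta> - 1" and b = "\<theta> + 1"
        and w = "\<lambda>\<omega>. 2 * \<bar>u\<bar> * norm \<omega> + (2 * \<bar>u\<bar> * norm \<omega>)\<^sup>2"])
    show "((\<lambda>s. - (u * z' s \<omega>) * sin (u * z s \<omega>)) has_vector_derivative
        u * z s \<omega> * sin (u * z s \<omega>) - (u * z' s \<omega>)\<^sup>2 * cos (u * z s \<omega>)) (at s)" for s \<omega>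
      unfolding has_real_derivative_iff_has_vector_derivative[symmetric]
      by (auto intro!: derivative_eq_intros z_deriv z'_deriv simp: power2_eq_square)
    show "integrable ?\<sigma> (\<lambda>\<omega>. 2 * \<bar>u\<bar> * norm \<omega> + (2 * \<bar>u\<bar> * norm \<omega>)\<^sup>2)"
      by (rule integrable_sphere_measure[of _ "2 * \<bar>u\<bar> + (2 * \<bar>u\<bar>)\<^sup>2"]) auto
  qed (use 1 bound2 in auto)
  have "(\<integral>\<omega>. cos (u * z \<theta> \<omega>) \<partial>?\<sigma>) = sphere_kernel i u" for \<theta>
  proof -
    define a where "a = u *\<^sub>R (cos \<theta> *\<^sub>R axis i 1 + sin \<theta> *\<^sub>R axis j 1 :: real ^ 'n)"
    have "(norm a)\<^sup>2 = u\<^sup>2"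
      unfolding a_def using assms
      by (simp add: power_mult_distrib power2_norm_eq_inner inner_add_left inner_add_right
          inner_axis_axis power2_eq_square[symmetric])
    then have "norm a = norm (u *\<^sub>R axis i 1 :: real ^ 'n)"
      by - (rule power2_eq_imp_eq, simp_all)
    from integral_sphere_measure_cos_cong[OF this]
    show ?thesis
      by (simp add: a_def z_def sphere_kernel_def inner_add_left inner_axis' algebra_simps)
  qed
  \<comment> \<open>The integral is constant in the angle, so its first derivative vanishes at every
    \<open>\<theta>\<close>, not just at 0; this is what permits differentiating once more.\<close>
  then have "((\<lambda>\<theta>. sphere_kernel i u) has_vector_derivative
      (\<integral>\<omega>. - (u * z' \<theta> \<omega>) * sin (u * z \<theta> \<omega>) \<partial>?\<sigma>)) (at \<theta>)" for \<theta>
    using deriv1[of \<theta>] by simp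
  then have "(\<integral>\<omega>. - (u * z' \<theta> \<omega>) * sin (u * z \<theta> \<omega>) \<partial>?\<sigma>) = 0" for \<theta>
    using vector_derivative_unique_at[OF _ has_vector_derivative_const] by blast
  then have "((\<lambda>\<theta>. 0) has_vector_derivative
      (\<integral>\<omega>. u * z 0 \<omega> * sin (u * z 0 \<omega>) - (u * z' 0 \<omega>)\<^sup>2 * cos (u * z 0 \<omega>) \<partial>?\<sigma>)) (at (0::real))"
    using deriv2[of 0] by simp
  then have "(\<integral>\<omega>. u * z 0 \<omega> * sin (u * z 0 \<omega>) - (u * z' 0 \<omega>)\<^sup>2 * cos (u * z 0 \<omega>) \<partial>?\<sigma>) = 0"
    using vector_derivative_unique_at[OF _ has_vector_derivative_const] by blast
  then have eq: "(\<integral>\<omega>. (- u) * (- (\<omega> $ i) * sin (u * \<omega> $ i)) + (- u\<^sup>2) * ((\<omega> $ j)\<^sup>2 * cos (u * \<omega> $ i)) \<partial>?\<sigma>) = 0"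
    by (simp add: z_def z'_def power_mult_distrib mult_ac)
  have cmp: "\<bar>\<omega> $ l\<bar> \<le> 1" if "norm \<omega> = 1" for \<omega> :: "real ^ 'n" and l
    using component_le_norm_cart[of \<omega> l] that by simp
  have "integrable ?\<sigma> (\<lambda>\<omega>. - (\<omega> $ i) * sin (u * \<omega> $ i))"
    using cmp by (intro integrable_sphere_measure[of _ 1]) (auto simp: abs_mult intro!: mult_le_one)
  moreover have "integrable ?\<sigma> (\<lambda>\<omega>. (\<omega> $ j)\<^sup>2 * cos (u * \<omega> $ i))"
    using cmp by (intro integrable_sphere_measure[of _ 1]) (auto simp: abs_mult abs_square_le_1 intro!: mult_le_one)
  ultimately have "(- u) * sphere_kernel' i u + (- u\<^sup>2) * (\<integral>\<omega>. (\<omega> $ j)\<^sup>2 * cos (u * \<omega> $ i) \<partial>?\<sigma>) = 0"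
    using eq unfolding sphere_kernel'_def
    by (subst (asm) Bochner_Integration.integral_add) simp_all
  then show ?thesis by simp
qed

text \<open>On the sphere the squares of the coordinates add up to 1, which splits the kernel into
  one integral per coordinate. The one for \<open>i\<close> is \<open>- sphere_kernel'' i u\<close>;
  each of the other \<open>CARD('n) - 1\<close> equals \<open>- sphere_kernel' i u / u\<close> by
  the rotation identity.\<close>

lemma sphere_kernel_ode:
  fixes i :: "'n::finite"
  assumes "u > 0"
  shows "u * sphere_kernel'' i u + (real CARD('n) - 1) * sphere_kernel' i u + u * sphere_kernel i u = 0"
proof -
  let ?\<sigma> = "sphere_measure :: (real ^ 'n) measure"
  have cmp: "\<bar>\<omega> $ l\<bar> \<le> 1" if "norm \<omega> = 1" for \<omega> :: "real ^ 'n" and l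
    using component_le_norm_cart[of \<omega> l] that by simp
  have int: "integrable ?\<sigma> (\<lambda>\<omega>. (\<omega> $ j)\<^sup>2 * cos (u * \<omega> $ i))" for j
    using cmp by (intro integrable_sphere_measure[of _ 1]) (auto simp: abs_mult abs_square_le_1 intro!: mult_le_one)
  have k': "sphere_kernel' i u = - u * (\<integral>\<omega>. (\<omega> $ j)\<^sup>2 * cos (u * \<omega> $ i) \<partial>?\<sigma>)" if "j \<noteq> i" for j
  proof -
    have "u * sphere_kernel' i u = u * (- u * (\<integral>\<omega>. (\<omega> $ j)\<^sup>2 * cos (u * \<omega> $ i) \<partial>?\<sigma>))"
      using sphere_kernel'_eq[of i j u] that by (simp add: power2_eq_square mult_ac)
    then show ?thesis using assms by (simp only: mult_cancel_left) simp
  qed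
  have k'': "sphere_kernel'' i u = - (\<integral>\<omega>. (\<omega> $ i)\<^sup>2 * cos (u * \<omega> $ i) \<partial>?\<sigma>)"
    unfolding sphere_kernel''_def by simp
  have "sphere_kernel i u = (\<integral>\<omega>. (\<Sum>j\<in>UNIV. (\<omega> $ j)\<^sup>2 * cos (u * \<omega> $ i)) \<partial>?\<sigma>)"
    unfolding sphere_kernel_def
  proof (rule integral_cong_AE)
    show "AE \<omega> in ?\<sigma>. cos (u * \<omega> $ i) = (\<Sum>j\<in>UNIV. (\<omega> $ j)\<^sup>2 * cos (u * \<omega> $ i))"
      using AE_sphere_measure
    proof eventually_elim
      case (elim \<omega>)
      then have "(\<Sum>j\<in>UNIV. (\<omega> $ j)\<^sup>2) = 1"
        by (simp add: norm_vec_def L2_set_def)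
      then show ?case by (simp add: sum_distrib_right[symmetric])
    qed
  qed auto
  also have "\<dots> = (\<Sum>j\<in>UNIV. \<integral>\<omega>. (\<omega> $ j)\<^sup>2 * cos (u * \<omega> $ i) \<partial>?\<sigma>)"
    using int by (rule Bochner_Integration.integral_sum)
  also have "\<dots> = - sphere_kernel'' i u + (\<Sum>j\<in>UNIV - {i}. \<integral>\<omega>. (\<omega> $ j)\<^sup>2 * cos (u * \<omega> $ i) \<partial>?\<sigma>)"
    by (subst sum.remove[of _ i]) (auto simp: k'')
  finally have K: "sphere_kernel i u = - sphere_kernel'' i u
      + (\<Sum>j\<in>UNIV - {i}. \<integral>\<omega>. (\<omega> $ j)\<^sup>2 * cos (u * \<omega> $ i) \<partial>?\<sigma>)" .
  have "u * sphere_kernel i u = - u * sphere_kernel'' i u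
      - (\<Sum>j\<in>UNIV - {i}. - u * (\<integral>\<omega>. (\<omega> $ j)\<^sup>2 * cos (u * \<omega> $ i) \<partial>?\<sigma>))"
    unfolding K by (simp add: sum_negf sum_distrib_left[symmetric] right_diff_distrib)
  also have "(\<Sum>j\<in>UNIV - {i}. - u * (\<integral>\<omega>. (\<omega> $ j)\<^sup>2 * cos (u * \<omega> $ i) \<partial>?\<sigma>))
      = (\<Sum>j\<in>UNIV - {i}. sphere_kernel' i u)"
    by (rule sum.cong) (auto simp: k')
  also have "\<dots> = (real CARD('n) - 1) * sphere_kernel' i u"
    by (simp add: of_nat_diff Suc_leI)
  finally show ?thesis by simp
qed

section \<open>Radial Fourier transforms\<close>

lemma sigma_finite_lebesgue: "sigma_finite_measure (lebesgue :: 'a::euclidean_space measure)"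
proof
  obtain A :: "'a set set" where "countable A" "A \<subseteq> sets lborel" "\<Union> A = space lborel"
    "\<forall>a\<in>A. emeasure lborel a \<noteq> \<infinity>"
    using lborel.sigma_finite_countable by blast
  then show "\<exists>A. countable A \<and> A \<subseteq> sets lebesgue \<and> \<Union> A = space (lebesgue :: 'a measure)
      \<and> (\<forall>a\<in>A. emeasure lebesgue a \<noteq> \<infinity>)"
    by (intro exI[of _ A]) (auto simp: subset_iff)
qed

lemma borel_measurable_lebesgueI:
  "f \<in> borel_measurable borel \<Longrightarrow> f \<in> borel_measurable lebesgue"
  by (rule measurable_completion) simp

lemma fourier_transform_orthogonal:
  fixes \<Phi> :: "real ^ 'n \<Rightarrow> complex"
  assumes "radial \<Phi>" and [measurable]: "\<Phi> \<in> borel_measurable lebesgue"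
    and Q: "orthogonal_transformation Q"
  shows "fourier_transform \<Phi> (Q v) = fourier_transform \<Phi> v"
proof -
  let ?e = "\<lambda>x v :: real ^ 'n. exp (- (2 * complex_of_real pi * \<i> * complex_of_real (x \<bullet> v)))"
  have [measurable]: "(\<lambda>x. x \<bullet> Q v) \<in> borel_measurable lebesgue"
    by (rule borel_measurable_lebesgueI) simp
  note [measurable] = distr_lebesgue_orthogonal(1)[OF Q]
  have "matrix Q *v x = Q x" for x
    using fun_cong[OF matrix_vector_mul(2)[OF orthogonal_transformation_linear[OF Q]], of x] by simp
  moreover have "orthogonal_matrix (matrix Q)"
    using Q orthogonal_transformation_matrix by blast
  ultimately have \<Phi>: "\<Phi> (Q x) = \<Phi> x" for x
    using \<open>radial \<Phi>\<close> unfolding radial_def by metis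
  have "fourier_transform \<Phi> (Q v) = (\<integral>x. ?e x (Q v) * \<Phi> x \<partial>distr lebesgue lebesgue Q)"
    by (simp add: fourier_transform_def distr_lebesgue_orthogonal(2)[OF Q])
  also have "\<dots> = (\<integral>x. ?e (Q x) (Q v) * \<Phi> (Q x) \<partial>lebesgue)"
    by (rule integral_distr) measurable
  also have "\<dots> = fourier_transform \<Phi> v"
    using Q by (simp add: fourier_transform_def \<Phi> orthogonal_transformation_def)
  finally show ?thesis .
qed

text \<open>Negation is orthogonal, so the transform is even; averaging its values at
  \<open>v\<close> and \<open>- v\<close> leaves the cosine.\<close>

lemma fourier_transform_radial_eq_cos:
  fixes \<Phi> :: "real ^ 'n \<Rightarrow> complex"
  assumes "radial \<Phi>" and \<Phi>: "integrable lebesgue \<Phi>"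
  shows "fourier_transform \<Phi> v = (\<integral>x. cos (2 * pi * (x \<bullet> v)) *\<^sub>R \<Phi> x \<partial>lebesgue)"
proof -
  let ?e = "\<lambda>x v :: real ^ 'n. exp (- (2 * complex_of_real pi * \<i> * complex_of_real (x \<bullet> v)))"
  have [measurable]: "\<Phi> \<in> borel_measurable lebesgue" using \<Phi> by auto
  have e_cis: "?e x v = cis (- (2 * pi * (x \<bullet> v)))" for x v
    by (simp add: cis_conv_exp mult_ac)
  have int: "integrable lebesgue (\<lambda>x. ?e x v * \<Phi> x)" for v
  proof (rule Bochner_Integration.integrable_bound[OF \<Phi>])
    have [measurable]: "(\<lambda>x. x \<bullet> v) \<in> borel_measurable lebesgue"
      by (rule borel_measurable_lebesgueI) simp
    show "(\<lambda>x. ?e x v * \<Phi> x) \<in> borel_measurable lebesgue" by measurable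
    show "AE x in lebesgue. norm (?e x v * \<Phi> x) \<le> norm (\<Phi> x)"
      by (simp add: e_cis norm_mult)
  qed
  have "fourier_transform \<Phi> v + fourier_transform \<Phi> (- v) = (\<integral>x. ?e x v * \<Phi> x + ?e x (- v) * \<Phi> x \<partial>lebesgue)"
    unfolding fourier_transform_def by (rule Bochner_Integration.integral_add[symmetric]) (rule int)+
  also have "\<dots> = (\<integral>x. 2 *\<^sub>R (cos (2 * pi * (x \<bullet> v)) *\<^sub>R \<Phi> x) \<partial>lebesgue)"
  proof (rule Bochner_Integration.integral_cong[OF refl])
    fix x :: "real ^ 'n"
    have "?e x v + ?e x (- v) = 2 *\<^sub>R complex_of_real (cos (2 * pi * (x \<bullet> v)))"
      unfolding e_cis by (simp add: complex_eq_iff)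
    then show "?e x v * \<Phi> x + ?e x (- v) * \<Phi> x = 2 *\<^sub>R (cos (2 * pi * (x \<bullet> v)) *\<^sub>R \<Phi> x)"
      by (simp only: distrib_right[symmetric]) (simp add: scaleR_conv_of_real)
  qed
  also have "\<dots> = 2 *\<^sub>R (\<integral>x. cos (2 * pi * (x \<bullet> v)) *\<^sub>R \<Phi> x \<partial>lebesgue)"
    by (rule integral_scaleR_right)
  also have "fourier_transform \<Phi> (- v) = fourier_transform \<Phi> v"
    by (rule fourier_transform_orthogonal[OF assms(1)])
      (simp_all add: orthogonal_transformation_def linear_iff)
  finally show ?thesis by (simp add: scaleR_2[symmetric])
qed

text \<open>The mean is taken over the direction of \<open>v\<close> instead of \<open>x\<close>:
  the transform has the same value at all vectors \<open>norm v *\<^sub>R \<omega>\<close> with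
  \<open>\<omega>\<close> on the sphere, and Fubini moves the mean inside, onto the cosine.\<close>

lemma fourier_transform_radial_eq_sphere_kernel:
  fixes \<Phi> :: "real ^ 'n \<Rightarrow> complex" and i :: 'n
  assumes "radial \<Phi>" and \<Phi>: "integrable lebesgue \<Phi>"
  shows "fourier_transform \<Phi> v = (\<integral>x. sphere_kernel i (2 * pi * norm x * norm v) *\<^sub>R \<Phi> x \<partial>lebesgue)"
proof -
  let ?\<sigma> = "sphere_measure :: (real ^ 'n) measure"
  interpret finite_measure ?\<sigma> by (rule finite_measure_sphere_measure)
  interpret L: sigma_finite_measure "lebesgue :: (real ^ 'n) measure" by (rule sigma_finite_lebesgue)
  interpret P: pair_sigma_finite "lebesgue :: (real ^ 'n) measure" ?\<sigma> ..
  have [measurable]: "\<Phi> \<in> borel_measurable lebesgue" using \<Phi> by auto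
  have [measurable]: "(\<lambda>x :: real ^ 'n. x) \<in> borel_measurable lebesgue"
    by (rule borel_measurable_lebesgueI) simp
  define f where "f x \<omega> = cos (2 * pi * (x \<bullet> (norm v *\<^sub>R \<omega>))) *\<^sub>R \<Phi> x" for x \<omega> :: "real ^ 'n"
  have meas [measurable]: "case_prod f \<in> borel_measurable (lebesgue \<Otimes>\<^sub>M ?\<sigma>)"
    unfolding f_def by measurable
  have f_le: "norm (f x \<omega>) \<le> norm (\<Phi> x)" for x \<omega>
    unfolding f_def by (simp add: mult_left_le_one_le)
  have int_\<sigma>: "integrable ?\<sigma> (f x)" for x
  proof (rule integrable_sphere_measure[OF _ f_le])
    show "f x \<in> borel_measurable borel"
      unfolding f_def[abs_def] by (intro borel_measurable_scaleR borel_measurable_const) measurable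
  qed
  have int: "integrable (lebesgue \<Otimes>\<^sub>M ?\<sigma>) (case_prod f)"
  proof (rule P.Fubini_integrable)
    show "integrable lebesgue (\<lambda>x. \<integral>y. norm (case_prod f (x, y)) \<partial>?\<sigma>)"
    proof (rule Bochner_Integration.integrable_bound[OF \<Phi>])
      show "AE x in lebesgue. norm (\<integral>y. norm (case_prod f (x, y)) \<partial>?\<sigma>) \<le> norm (\<Phi> x)"
      proof (rule AE_I2)
        fix x :: "real ^ 'n"
        have "norm (\<integral>y. norm (f x y) \<partial>?\<sigma>) = (\<integral>y. norm (f x y) \<partial>?\<sigma>)" by simp
        also have "\<dots> \<le> (\<integral>y. norm (\<Phi> x) \<partial>?\<sigma>)"
          using int_\<sigma> f_le by (intro integral_mono) auto
        also have "\<dots> = norm (\<Phi> x)" by (simp add: measure_sphere_measure_UNIV)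
        finally show "norm (\<integral>y. norm (case_prod f (x, y)) \<partial>?\<sigma>) \<le> norm (\<Phi> x)" by simp
      qed
    qed measurable
  qed (use int_\<sigma> in auto)
  have "fourier_transform \<Phi> v = (\<integral>\<omega>. fourier_transform \<Phi> v \<partial>?\<sigma>)"
    by (simp add: measure_sphere_measure_UNIV)
  also have "\<dots> = (\<integral>\<omega>. (\<integral>x. f x \<omega> \<partial>lebesgue) \<partial>?\<sigma>)"
  \<comment> \<open>Only unit vectors \<open>\<omega>\<close> admit an orthogonal map from
    \<open>v\<close> to \<open>norm v *\<^sub>R \<omega>\<close>.\<close>
  proof (rule integral_cong_AE)
    show "AE \<omega> in ?\<sigma>. fourier_transform \<Phi> v = (\<integral>x. f x \<omega> \<partial>lebesgue)"
      using AE_sphere_measure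
    proof eventually_elim
      case (elim \<omega>)
      then have "norm v = norm (norm v *\<^sub>R \<omega>)" by simp
      from orthogonal_transformation_exists[OF this]
      obtain Q where Q: "orthogonal_transformation Q" "Q v = norm v *\<^sub>R \<omega>" .
      show ?case
        using fourier_transform_orthogonal[OF assms(1) _ Q(1), of v]
          fourier_transform_radial_eq_cos[OF assms, of "Q v"]
        by (simp add: Q(2) f_def)
    qed
  qed measurable
  also have "\<dots> = (\<integral>x. (\<integral>\<omega>. f x \<omega> \<partial>?\<sigma>) \<partial>lebesgue)"
    by (rule P.Fubini_integral[OF int])
  also have "\<dots> = (\<integral>x. sphere_kernel i (2 * pi * norm x * norm v) *\<^sub>R \<Phi> x \<partial>lebesgue)"
  proof (rule Bochner_Integration.integral_cong[OF refl])
    fix x :: "real ^ 'n"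
    have "integrable ?\<sigma> (\<lambda>\<omega>. cos ((2 * pi * norm v) *\<^sub>R x \<bullet> \<omega>))"
      by (rule integrable_sphere_measure[of _ 1]) auto
    then have "(\<integral>\<omega>. cos ((2 * pi * norm v) *\<^sub>R x \<bullet> \<omega>) *\<^sub>R \<Phi> x \<partial>?\<sigma>) =
        (\<integral>\<omega>. cos ((2 * pi * norm v) *\<^sub>R x \<bullet> \<omega>) \<partial>?\<sigma>) *\<^sub>R \<Phi> x"
      by (intro integral_scaleR_left)
    also have "\<dots> = sphere_kernel i (2 * pi * norm x * norm v) *\<^sub>R \<Phi> x"
      unfolding integral_sphere_measure_cos[of _ i] by (simp add: mult_ac)
    finally show "(\<integral>\<omega>. f x \<omega> \<partial>?\<sigma>) = sphere_kernel i (2 * pi * norm x * norm v) *\<^sub>R \<Phi> x"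
      by (simp add: f_def mult_ac)
  qed
  finally show ?thesis .
qed

section \<open>Differentiation under the integral in the variable \<open>s\<close>\<close>

lemma scaled_sequence_has_derivative:
  fixes \<kappa> :: "nat \<Rightarrow> real \<Rightarrow> real"
  assumes deriv: "\<And>n s. s > 0 \<Longrightarrow> (\<kappa> n has_real_derivative \<kappa> (Suc n) s) (at s)"
    and "y \<ge> 0" "s > 0"
  shows "((\<lambda>s. y ^ n * \<kappa> n (y * s)) has_real_derivative y ^ Suc n * \<kappa> (Suc n) (y * s)) (at s)"
\<comment> \<open>For \<open>y = 0\<close> the function is constant in \<open>s\<close> and the
  claimed derivative is 0. This case is separate because \<open>deriv\<close> says nothing about
  \<open>\<kappa> n\<close> at 0.\<close>
proof (cases "y = 0")
  case False
  then have "y * s > 0" using assms by simp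
  from DERIV_chain'[where f = "\<lambda>s. y * s" and g = "\<kappa> n", OF DERIV_cmult_Id deriv[OF this]]
  have "((\<lambda>s. \<kappa> n (y * s)) has_real_derivative \<kappa> (Suc n) (y * s) * y) (at s)"
    by simp
  from DERIV_cmult[OF this, of "y ^ n"] show ?thesis by (simp add: mult_ac)
qed auto

text \<open>Each derivative costs a factor \<open>(norm x)\<^sup>2\<close> under the integral, which the decay
  of \<open>\<kappa> n\<close> compensates as long as \<open>n \<le> m\<close>; so the integrals stay dominated by \<open>norm (\<Phi> x)\<close>.\<close>
lemma kernel_integral_derivatives:
  fixes \<kappa> :: "nat \<Rightarrow> real \<Rightarrow> real" and \<Phi> :: "'a \<Rightarrow> 'b::{banach, second_countable_topology}"
  assumes deriv: "\<And>n s. s > 0 \<Longrightarrow> (\<kappa> n has_real_derivative \<kappa> (Suc n) s) (at s)"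
    and meas [measurable]: "\<And>n. \<kappa> n \<in> borel_measurable borel"
    and bound: "\<And>n. n \<le> m \<Longrightarrow> \<exists>C. \<forall>s>0. \<bar>s ^ n * \<kappa> n s\<bar> \<le> C"
    and \<Phi>: "integrable M \<Phi>"
    and y [measurable]: "y \<in> borel_measurable M" and y_nonneg: "\<And>x. y x \<ge> 0"
  defines "G \<equiv> \<lambda>n s. \<integral>x. (y x ^ n * \<kappa> n (y x * s)) *\<^sub>R \<Phi> x \<partial>M"
  shows "\<And>n s. n < m \<Longrightarrow> s > 0 \<Longrightarrow> (G n has_vector_derivative G (Suc n) s) (at s)"
    and "continuous_on {0<..} (G m)"
proof -
  have [measurable]: "\<Phi> \<in> borel_measurable M" using \<Phi> by auto
  have "\<exists>C. \<forall>x s. s0 / 2 < s \<longrightarrow> norm ((y x ^ n * \<kappa> n (y x * s)) *\<^sub>R \<Phi> x) \<le> C * norm (\<Phi> x)"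
    if "n \<le> m" "s0 > 0" for n s0
  proof -
    obtain C where C: "\<And>s. s > 0 \<Longrightarrow> \<bar>s ^ n * \<kappa> n s\<bar> \<le> C" using bound[OF \<open>n \<le> m\<close>] by blast
    \<comment> \<open>The first entry covers \<open>y x = 0\<close>, where only \<open>n = 0\<close>
      gives a nonzero term. The second comes from the bound \<open>C / s ^ n\<close> and
      \<open>s > s0 / 2\<close>.\<close>
    define B where "B = max \<bar>\<kappa> 0 0\<bar> (C / (s0 / 2) ^ n)"
    have C0: "C \<ge> 0" using C[of 1] by simp
    have "\<bar>y x ^ n * \<kappa> n (y x * s)\<bar> \<le> B" if s: "s0 / 2 < s" for x s
    proof (cases "y x = 0")
      case True
      then show ?thesis using C0 \<open>s0 > 0\<close> by (cases n) (auto simp: B_def le_max_iff_disj)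
    next
      case False
      have s_pos: "s > 0" using s \<open>s0 > 0\<close> by simp
      then have "y x * s > 0" using False y_nonneg[of x] by simp
      from C[OF this] have "s ^ n * \<bar>y x ^ n * \<kappa> n (y x * s)\<bar> \<le> C"
        using s_pos by (simp add: power_mult_distrib abs_mult mult_ac)
      then have "\<bar>y x ^ n * \<kappa> n (y x * s)\<bar> \<le> C / s ^ n"
        using s_pos by (simp add: pos_le_divide_eq mult.commute)
      also have "\<dots> \<le> C / (s0 / 2) ^ n"
        using s \<open>s0 > 0\<close> C0 by (intro divide_left_mono power_mono) auto
      also have "\<dots> \<le> B" by (simp add: B_def)
      finally show ?thesis .
    qed
    then show ?thesis by (intro exI[of _ B]) (auto intro!: mult_right_mono)
  qed
  then obtain C where C: "\<And>n s0 x s. n \<le> m \<Longrightarrow> s0 > 0 \<Longrightarrow> s0 / 2 < s \<Longrightarrow>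
      norm ((y x ^ n * \<kappa> n (y x * s)) *\<^sub>R \<Phi> x) \<le> C n s0 * norm (\<Phi> x)"
    by metis
  have int_C: "integrable M (\<lambda>x. C n s0 * norm (\<Phi> x))" for n s0 using \<Phi> by simp
  have m: "(\<lambda>x. (y x ^ n * \<kappa> n (y x * s)) *\<^sub>R \<Phi> x) \<in> borel_measurable M" for n s by measurable
  have d: "((\<lambda>s. (y x ^ n * \<kappa> n (y x * s)) *\<^sub>R \<Phi> x) has_vector_derivative
      (y x ^ Suc n * \<kappa> (Suc n) (y x * s)) *\<^sub>R \<Phi> x) (at s)" if "s > 0" for x n s
    using has_vector_derivative_scaleR[OF scaled_sequence_has_derivative[of \<kappa> "y x" s n, OF deriv y_nonneg that]
        has_vector_derivative_const[of "\<Phi> x"]]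
    by simp
  show "(G n has_vector_derivative G (Suc n) s0) (at s0)" if "n < m" "s0 > 0" for n s0
    unfolding G_def
  \<comment> \<open>The derivative is dominated by the constant of index \<open>Suc n\<close>,
    available because \<open>n < m\<close>. The left endpoint \<open>s0 / 2\<close> keeps the
    interval away from 0, where the bound \<open>C / s ^ n\<close> degenerates.\<close>
  proof (rule has_vector_derivative_integral[where a = "s0 / 2" and b = "2 * s0"
        and w = "\<lambda>x. C (Suc n) s0 * norm (\<Phi> x)"])
    show "integrable M (\<lambda>x. (y x ^ n * \<kappa> n (y x * s)) *\<^sub>R \<Phi> x)" if "s \<in> {s0 / 2<..<2 * s0}" for s
      using that C[of n s0 s] \<open>n < m\<close> \<open>s0 > 0\<close>
      by (intro Bochner_Integration.integrable_bound[OF int_C[of n s0] m] AE_I2)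
        (auto intro: order_trans[OF _ abs_ge_self])
  qed (use that d C[of "Suc n" s0] int_C m in auto)
  show "continuous_on {0<..} (G m)"
  proof (rule continuous_at_imp_continuous_on, safe)
    fix s0 :: real assume "s0 > 0"
    then show "isCont (G m) s0"
      unfolding G_def
      by (intro continuous_integral[where a = "s0 / 2" and b = "2 * s0" and w = "\<lambda>x. C m s0 * norm (\<Phi> x)"]
          has_vector_derivative_continuous[OF d] m int_C C) auto
  qed
qed

theorem corollary3p4:
  fixes \<Phi> :: "real ^ 'n \<Rightarrow> complex"
  assumes "CARD('n) \<ge> 2"
    and "integrable lebesgue \<Phi>"
    and "radial \<Phi>"
  shows "continuously_differentiable_on ((CARD('n) - 2) div 2) (fourier_transform \<Phi>) (UNIV - {0})"
proof -
  \<comment> \<open>This is the largest \<open>m\<close> with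
    \<open>2 * m + 2 \<le> CARD('n)\<close>, the condition of the energy estimate.\<close>
  define m where "m = (CARD('n) - 2) div 2"
  have m: "CARD('n) \<ge> 2 * m + 2" using assms(1) by (simp add: m_def)
  obtain i :: 'n where True by simp
  define \<kappa> where "\<kappa> = bessel_seq CARD('n) (sphere_kernel i) (sphere_kernel' i)"
  \<comment> \<open>Chosen so that \<open>y x * (v \<bullet> v)\<close> is the square of the
    kernel's argument \<open>2 * pi * norm x * norm v\<close>.\<close>
  define y where "y x = 4 * pi\<^sup>2 * (norm x)\<^sup>2" for x :: "real ^ 'n"
  have deriv: "(\<kappa> n has_real_derivative \<kappa> (Suc n) s) (at s)" if "s > 0" for n s
    unfolding \<kappa>_def
    by (rule bessel_seq_has_derivative[OF sphere_kernel_has_derivative sphere_kernel'_has_derivative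
          sphere_kernel_ode that])
  have "continuous_on UNIV (sphere_kernel i)" "continuous_on UNIV (sphere_kernel' i)"
    using sphere_kernel_has_derivative sphere_kernel'_has_derivative DERIV_isCont
    by (blast intro: continuous_at_imp_continuous_on)+
  then have meas: "\<kappa> n \<in> borel_measurable borel" for n
    unfolding \<kappa>_def by (intro borel_measurable_bessel_seq borel_measurable_continuous_onI)
  have bound: "\<exists>C. \<forall>s>0. \<bar>s ^ n * \<kappa> n s\<bar> \<le> C" if "n \<le> m" for n
  proof -
    \<comment> \<open>The bound on \<open>sphere_kernel'\<close> alone leaves a factor
      \<open>1 / sqrt s\<close> in \<open>\<kappa> 1\<close>; the weight \<open>s\<close> removes
      this singularity and starts the recursion near 0.\<close>
    have 1: "\<bar>s * \<kappa> 1 s\<bar> \<le> sqrt s" if "s > 0" for s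
    proof -
      have "s * \<kappa> 1 s = s / sqrt s * (sphere_kernel' i (sqrt s) / 2)"
        by (simp add: \<kappa>_def)
      also have "s / sqrt s = sqrt s" using that by (intro real_div_sqrt) simp
      finally have "s * \<kappa> 1 s = sqrt s * (sphere_kernel' i (sqrt s) / 2)" .
      then have "\<bar>s * \<kappa> 1 s\<bar> = \<bar>sqrt s * (sphere_kernel' i (sqrt s) / 2)\<bar>"
        by (rule arg_cong)
      also have "\<dots> = sqrt s * (\<bar>sphere_kernel' i (sqrt s)\<bar> / 2)"
        using that by (simp add: abs_mult)
      also have "\<dots> \<le> sqrt s * 1"
        using abs_sphere_kernel'_le[of i "sqrt s"] that by (intro mult_left_mono) auto
      finally show ?thesis by simp
    qed
    show ?thesis
      by (rule bessel_sequence_bounded[of \<kappa> "CARD('n)" m n, OF deriv _ _ 1 m that])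
        (auto simp: \<kappa>_def abs_sphere_kernel_le bessel_seq_rec simp del: bessel_seq.simps(2,3))
  qed
  have y_meas: "y \<in> borel_measurable lebesgue"
    by (rule borel_measurable_lebesgueI) (simp add: y_def[abs_def])
  have y_nonneg: "y x \<ge> 0" for x by (simp add: y_def)
  define G where "G n s = (\<integral>x. (y x ^ n * \<kappa> n (y x * s)) *\<^sub>R \<Phi> x \<partial>lebesgue)" for n s
  note G = kernel_integral_derivatives[where m = m, OF deriv meas bound assms(2) y_meas y_nonneg, folded G_def]
  have "fourier_transform \<Phi> v = 1 *\<^sub>R G 0 (v \<bullet> v)" for v
  proof -
    have "sqrt (y x * (v \<bullet> v)) = 2 * pi * norm x * norm v" for x
      by (rule real_sqrt_unique)
        (simp_all add: y_def power_mult_distrib power2_norm_eq_inner)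
    then show ?thesis
      unfolding fourier_transform_radial_eq_sphere_kernel[OF assms(3,2), of v i]
      by (simp add: G_def \<kappa>_def)
  qed
  then have "fourier_transform \<Phi> = (\<lambda>v. 1 *\<^sub>R G 0 (v \<bullet> v))" by blast
  moreover have "continuously_differentiable_on m (\<lambda>v. 1 *\<^sub>R G 0 (v \<bullet> v)) (UNIV - {0})"
    by (rule continuously_differentiable_on_inner_self[where G = G and p = "\<lambda>_. 1" and m = m])
      (use G in auto)
  ultimately show ?thesis by (simp only: m_def)
qed

end
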